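(* Let $S$, $\mathcal{F}$, $\mathcal{G}$, $q$, $\tilde q$, $\{\boldsymbol{a}_j\}$, $\{b_j\}$, $\mathcal{H}$, $C^q_{\mathcal{G}}(\overline S)$, $\mathcal{F}_{\mathcal{G}}$, the point clouds, $h_{\max}$, the set of eigenvalues $\{\lambda_j\}$ and the discrete solution $\tilde u_\lambda$ be as defined in the context. Fix an eigenvalue $\lambda_k$, write $\mathcal{N}_k:=\mathcal{N}(\mathcal{F}_{\mathcal{G}}-\lambda_k)$ for its eigenspace, and let $\lambda$ range over the numbers that are closer to $\lambda_k$ than to any other eigenvalue in $\{\lambda_j\}$ (call these admissible). Assume: (1) There exist $\alpha_k\in\mathbb{C}$, $C_k>0$ and $\tilde s\in\mathbb{R}$ such that for any $C^{\tilde q}$ function $w$ the problem $(\mathcal{F}-\alpha_k)g=0$ on $S$, $\mathcal{G}g|_{\partial S}=\mathcal{G}w|_{\partial S}$ has at least one solution $g\in C^q(\overline S)$ with $\|g\|_{L^2(S)}\le C_k\|\mathcal{G}w\|_{H^{\tilde s}(\partial S)}$. (2) The set of eigenvalues $\{\lambda_j\}$ is countable. (3) $\mathcal{N}_k$ is closed as a subspace of $L^2(S)$. (4) There is $B_k>0$ such that for all admissible $\lambda$ and all $u\in\mathcal{N}_k^{\perp}\cap C^q_{\mathcal{G}}(\overline S)$, $B_k\|u\|_{L^2(S)}\le\|(\mathcal{F}_{\mathcal{G}}-\lambda)u\|_{L^2(S)}$. (5) There is $\theta_k\in[0,1)$ such that for all admissible $\lambda$, all $v\in\mathcal{N}_k^{\perp}\cap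 C^q_{\mathcal{G}}(\overline S)$ and all $u\in\mathcal{N}_k$, $$\big|\big((\mathcal{F}_{\mathcal{G}}-\lambda)v,u\big)_{L^2(S)}\big|\le\theta_k\|(\mathcal{F}_{\mathcal{G}}-\lambda)v\|_{L^2(S)}\|u\|_{L^2(S)}.$$ (6) There are constants $A,\tilde A,p,Q_a>0$ such that, for small enough $h_{\max}$ and all admissible $\lambda$, the discrete solution $\tilde u_\lambda$ exists and satisfies $$\|\mathcal{F}\tilde u_\lambda-\lambda\tilde u_\lambda\|_{L^2(S)}\le A h_{\max}^p\|\tilde u_\lambda\|_{\mathcal{H}},\quad \|\mathcal{G}\tilde u_\lambda\|_{H^{\tilde s}(\partial S)}\le\tilde A h_{\max}^p\|\tilde u_\lambda\|_{\mathcal{H}},\quad \|\tilde u_\lambda\|_{L^2(S)}\ge\frac{\max_j\{|b_j|\}\,Q_a}{\|\tilde u_\lambda\|_{\mathcal{H}}},$$ with $\tilde s$ as in (1). Then there exist constants $\tilde B_k,\tilde C_k,\Lambda_k,\tilde\Lambda_k>0$ (independent of $\lambda$ and of the point clouds) such that for small enough $h_{\max}$ and every admissible $\lambda$ there exists an eigenfunction $v_k\in\mathcal{N}_k$ such that, if $$(\tilde B_k+\Lambda_k|\lambda-\lambda_k|)\,h_{\max}^p\|\tilde u_\lambda\|_{\mathcal{H}}^2<\max_j\{|b_j|\}\,Q_a,$$ then $$|\lambda-\lambda_k|\le\frac{(\tilde C_k+\tilde\Lambda_k|\lambda-\lambda_k|)\,h_{\max}^p\|\tilde u_\lambda\|_{\mathcal{H}}^2}{\max_j\{|b_j|\}Q_a-(\tilde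 B_k+\Lambda_k|\lambda-\lambda_k|)\,h_{\max}^p\|\tilde u_\lambda\|_{\mathcal{H}}^2},$$ $$\frac{\|\tilde u_\lambda-v_k\|_{L^2(S)}}{\|v_k\|_{L^2(S)}}\le\frac{(\tilde B_k+\Lambda_k|\lambda-\lambda_k|)\,h_{\max}^p\|\tilde u_\lambda\|_{\mathcal{H}}^2}{\max_j\{|b_j|\}Q_a-(\tilde B_k+\Lambda_k|\lambda-\lambda_k|)\,h_{\max}^p\|\tilde u_\lambda\|_{\mathcal{H}}^2}.$$
   Context: Setting. $S$ is a bounded domain (a flat domain, or a manifold embedded in Euclidean space) with boundary $\partial S$, contained in a domain $\Omega$ with $\overline S\subseteq\Omega$; $\mathcal{F}$ is a linear differential operator of order $q$ and $\mathcal{G}$ is a linear differential operator of order $\tilde q\le q$. $\{\boldsymbol{a}_j\}_{j=1}^{\tilde N_a}$ are points of $S\cup\partial S$ and $\{b_j\}_{j=1}^{\tilde N_a}$ are values, at least one of which is non-zero. Eigenvalue problem: $\mathcal{F}u-\lambda u=0$ on $S$, $\mathcal{G}u|_{\partial S}=0$, $u(\boldsymbol{a}_j)=b_j$ for each $j\in\{1,\dots,\tilde N_a\}$. The set of eigenvalues $\{\lambda_j\}$ is the set of values of $\lambda$ for which a non-zero solution $u\in C^q(S)$ of this problem exists. $C^q_{\mathcal{G}}(\overline S):=\{u\in C^q(\overline S):\mathcal{G}u|_{\partial S}=0\}$, and $\mathcal{F}_{\mathcal{G}}:C^q_{\mathcal{G}}(\overline S)\to C(S)$ is the restriction of $\mathcal{F}$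 to $C^q_{\mathcal{G}}(\overline S)$. $\mathcal{N}(\cdot)$ denotes the null space, and $\perp$ denotes the orthogonal complement in $L^2(S)$. Discrete problem: $\mathcal{H}$ is a Hilbert space of functions on $\Omega$ whose restrictions to $\overline S$ are in $C^q(\overline S)$. $\{\boldsymbol{x}_j\}_{j=1}^{\infty}\subset S$ and $\{\boldsymbol{y}_j\}_{j=1}^{\infty}\subset\partial S$ are point sequences. The fill distance of a finite set $X$ in a set $D$ is $\sup_{\boldsymbol{x}\in D}\min_{\boldsymbol{z}\in X}\|\boldsymbol{x}-\boldsymbol{z}\|_2$; $h_{\max}$ denotes the fill distance of the point clouds $\{\boldsymbol{x}_j\}_{j=1}^{\tilde N}$ in $S$ and $\{\boldsymbol{y}_j\}_{j=1}^{\tilde N_\partial}$ in $\partial S$ (the larger of the two), and it is assumed that $h_{\max}\to0$ as $\tilde N,\tilde N_\partial\to\infty$. For given $\lambda,\tilde N,\tilde N_\partial$, the discrete solution $\tilde u_\lambda\in\mathcal{H}$ is the minimizer of $\|u\|_{\mathcal{H}}$ over all $u\in\mathcal{H}$ with $\mathcal{F}u(\boldsymbol{x}_j)-\lambda u(\boldsymbol{x}_j)=0$ for $1\le j\le\tilde N$, $\mathcal{G}u(\boldsymbol{y}_j)=0$ for $1\le j\le\tilde N_\partial$, and $u(\boldsymbol{a}_j)=b_j$ for $1\le j\le\tilde N_a$. *)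

theory Defs
  imports "HOL-Analysis.Analysis"
begin

section \<open>Functions of class \<open>C^k\<close> and differential operators\<close>

definition partial_deriv ::
    "'a::euclidean_space \<Rightarrow> ('a \<Rightarrow> 'b::real_normed_vector) \<Rightarrow> 'a \<Rightarrow> 'b" where
  "partial_deriv b f x = frechet_derivative f (at x) b"

text \<open>To be used for open \<open>U\<close> only.\<close>

primrec Ck_open ::
    "nat \<Rightarrow> 'a::euclidean_space set \<Rightarrow> ('a \<Rightarrow> 'b::real_normed_vector) \<Rightarrow> bool" where
  "Ck_open 0 U f \<longleftrightarrow> continuous_on U f"
| "Ck_open (Suc k) U f \<longleftrightarrow>
     (\<forall>x\<in>U. f differentiable (at x)) \<and> (\<forall>b\<in>Basis. Ck_open k U (partial_deriv b f))"

text \<open>Class \<open>C^{k,1}\<close> on an open set: the derivatives of order \<open>k\<close> are locally Lipschitz.\<close>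

primrec Ck1_open ::
    "nat \<Rightarrow> 'a::euclidean_space set \<Rightarrow> ('a \<Rightarrow> 'b::real_normed_vector) \<Rightarrow> bool" where
  "Ck1_open 0 U f \<longleftrightarrow> (\<forall>x\<in>U. \<exists>e>0. \<exists>L. L-lipschitz_on (U \<inter> ball x e) f)"
| "Ck1_open (Suc k) U f \<longleftrightarrow>
     (\<forall>x\<in>U. f differentiable (at x)) \<and> (\<forall>b\<in>Basis. Ck1_open k U (partial_deriv b f))"

text \<open>
  \<open>C^k\<close> on an arbitrary subset \<open>X\<close> of the ambient space (a domain, its closure, or a piece of an
  embedded manifold): near each point of \<open>X\<close> the function is the restriction of an ambient
  \<open>C^k\<close> function. Values outside \<open>X\<close> are irrelevant, so functions on \<open>X\<close> are represented by
  total functions.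
\<close>

definition Ck_on :: "nat \<Rightarrow> 'a::euclidean_space set \<Rightarrow> ('a \<Rightarrow> complex) \<Rightarrow> bool" where
  "Ck_on k X u \<longleftrightarrow>
     (\<forall>x\<in>X. \<exists>U g. open U \<and> x \<in> U \<and> Ck_open k U g \<and> (\<forall>z\<in>X \<inter> U. u z = g z))"

definition iter_partial ::
    "'a::euclidean_space list \<Rightarrow> ('a \<Rightarrow> 'b::real_normed_vector) \<Rightarrow> 'a \<Rightarrow> 'b" where
  "iter_partial bs g = foldr partial_deriv bs g"

text \<open>
  \<open>P\<close> is a linear differential operator of order (at most) \<open>k\<close>, applied to functions on \<open>X\<close> and
  evaluated at the points of \<open>Y \<subseteq> X\<close>. Partial derivatives are indexed by lists of
  basis vectors instead of multi-indices. They are taken of ambient \<open>C^k\<close> extensions \<open>g\<close> of \<open>u\<close>,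
  and the value has to be the same for all of them: on an embedded manifold this says that \<open>P\<close>
  is an operator on the manifold (it involves tangential derivatives only), while for \<open>X\<close> open,
  or the closure of a regular open set, all extensions have the same derivatives on \<open>X\<close>.
\<close>

definition differential_operator ::
    "nat \<Rightarrow> 'a::euclidean_space set \<Rightarrow> 'a set \<Rightarrow> (('a \<Rightarrow> complex) \<Rightarrow> 'a \<Rightarrow> complex) \<Rightarrow> bool" where
  "differential_operator k X Y P \<longleftrightarrow>
     (\<exists>c :: 'a list \<Rightarrow> 'a \<Rightarrow> complex.
        \<forall>x\<in>Y. \<forall>U g u. open U \<and> x \<in> U \<and> Ck_open k U g \<and> (\<forall>z\<in>X \<inter> U. u z = g z) \<longrightarrow>
          P u x = (\<Sum>bs | set bs \<subseteq> Basis \<and> length bs \<le> k. c bs x * iter_partial bs g x))"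


section \<open>Domains in embedded manifolds\<close>

definition embedded_submanifold :: "nat \<Rightarrow> nat \<Rightarrow> 'a::euclidean_space set \<Rightarrow> bool" where
  "embedded_submanifold r m M \<longleftrightarrow>
     (\<forall>x\<in>M. \<exists>U V. \<exists>f g :: 'a \<Rightarrow> 'a. \<exists>B. open U \<and> open V \<and> x \<in> U \<and> B \<subseteq> Basis \<and> card B = m \<and>
        homeomorphism U V f g \<and> Ck_open r U f \<and> Ck_open r V g \<and>
        f ` (M \<inter> U) = V \<inter> span B)"

text \<open>
  The flat case is \<open>M = UNIV\<close>, \<open>m = DIM('a)\<close>, where \<open>S\<close> is an ordinary bounded domain. A compact
  embedded manifold with boundary is the case where \<open>S\<close> is its interior and \<open>M\<close> a slightly larger
  manifold.
\<close>

definition bounded_domain_in :: "nat \<Rightarrow> nat \<Rightarrow> 'a::euclidean_space set \<Rightarrow> 'a set \<Rightarrow> bool" where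
  "bounded_domain_in r m M S \<longleftrightarrow>
     embedded_submanifold r m M \<and> S \<noteq> {} \<and> connected S \<and> bounded S \<and>
     openin (top_of_set M) S \<and> closure S \<subseteq> M"

text \<open>For \<open>S\<close> relatively open in \<open>M\<close> with closure in \<open>M\<close> this is the boundary of \<open>S\<close> in \<open>M\<close>;
  it is \<open>frontier S\<close> if \<open>S\<close> is open.\<close>

definition bd :: "'a::euclidean_space set \<Rightarrow> 'a set" where
  "bd S = closure S - S"

text \<open>
  A chart flattening the boundary: \<open>M\<close> becomes the span of \<open>tang\<close> and \<open>nrm\<close>, \<open>S\<close> the open half
  space of it, and the boundary of \<open>S\<close> the span of \<open>tang\<close>. The field \<open>cutoff\<close> is the member of a
  partition of unity that belongs to the chart.
\<close>

record 'a bchart =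
  src :: "'a set"
  tgt :: "'a set"
  fwd :: "'a \<Rightarrow> 'a"
  bwd :: "'a \<Rightarrow> 'a"
  tang :: "'a set"
  nrm :: 'a
  cutoff :: "'a \<Rightarrow> real"

definition boundary_chart ::
    "nat \<Rightarrow> nat \<Rightarrow> 'a::euclidean_space set \<Rightarrow> 'a set \<Rightarrow> 'a bchart \<Rightarrow> bool" where
  "boundary_chart k m M S c \<longleftrightarrow>
     open (src c) \<and> open (tgt c) \<and>
     homeomorphism (src c) (tgt c) (fwd c) (bwd c) \<and>
     Ck1_open k (src c) (fwd c) \<and> Ck1_open k (tgt c) (bwd c) \<and>
     tang c \<subseteq> Basis \<and> nrm c \<in> Basis - tang c \<and> card (insert (nrm c) (tang c)) = m \<and>
     fwd c ` (M \<inter> src c) = tgt c \<inter> span (insert (nrm c) (tang c)) \<and>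
     fwd c ` (S \<inter> src c) = tgt c \<inter> span (insert (nrm c) (tang c)) \<inter> {y. y \<bullet> nrm c > 0}"

text \<open>The boundary of \<open>S\<close> in \<open>M\<close> is of class \<open>C^{k,1}\<close>; \<open>k = 0\<close> is a Lipschitz boundary.\<close>

definition boundary_atlas ::
    "nat \<Rightarrow> nat \<Rightarrow> 'a::euclidean_space set \<Rightarrow> 'a set \<Rightarrow> 'a bchart set \<Rightarrow> bool" where
  "boundary_atlas k m M S \<A> \<longleftrightarrow>
     finite \<A> \<and>
     (\<forall>c\<in>\<A>. boundary_chart k m M S c \<and> Ck1_open k UNIV (cutoff c) \<and>
        (\<forall>x. cutoff c x \<ge> 0) \<and>
        (\<exists>K. compact K \<and> K \<subseteq> src c \<and> (\<forall>x. x \<notin> K \<longrightarrow> cutoff c x = 0))) \<and>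
     (\<forall>x\<in>bd S. (\<Sum>c\<in>\<A>. cutoff c x) = 1)"


section \<open>Surface measure\<close>

text \<open>
  The \<open>m\<close>-dimensional Hausdorff measure, normalised such that it is Lebesgue measure for
  \<open>m = DIM('a)\<close> and the usual surface measure on \<open>m\<close>-dimensional embedded manifolds.
\<close>

definition hausdorff_pre :: "nat \<Rightarrow> real \<Rightarrow> 'a::euclidean_space set \<Rightarrow> ennreal" where
  "hausdorff_pre m \<delta> A =
     (INF C\<in>{C :: nat \<Rightarrow> 'a set. A \<subseteq> (\<Union>i. C i) \<and> (\<forall>i. bounded (C i) \<and> diameter (C i) \<le> \<delta>)}.
        \<Sum>i. if C i = {} then 0 else ennreal (unit_ball_vol (real m) * (diameter (C i) / 2) ^ m))"

definition hausdorff_outer :: "nat \<Rightarrow> 'a::euclidean_space set \<Rightarrow> ennreal" where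
  "hausdorff_outer m A = (SUP \<delta>\<in>{0<..}. hausdorff_pre m \<delta> A)"

definition hausdorff_measure :: "nat \<Rightarrow> 'a::euclidean_space measure" where
  "hausdorff_measure m = measure_of UNIV (sets borel) (hausdorff_outer m)"


section \<open>The space \<open>L^2\<close>\<close>

definition L2 :: "'a measure \<Rightarrow> ('a \<Rightarrow> complex) set" where
  "L2 \<mu> = {f \<in> borel_measurable \<mu>. integrable \<mu> (\<lambda>x. (cmod (f x))\<^sup>2)}"

definition L2_inner :: "'a measure \<Rightarrow> ('a \<Rightarrow> complex) \<Rightarrow> ('a \<Rightarrow> complex) \<Rightarrow> complex" where
  "L2_inner \<mu> f g = (LINT x|\<mu>. f x * cnj (g x))"

definition L2_norm :: "'a measure \<Rightarrow> ('a \<Rightarrow> complex) \<Rightarrow> real" where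
  "L2_norm \<mu> f = sqrt (LINT x|\<mu>. (cmod (f x))\<^sup>2)"

definition L2_perp :: "'a measure \<Rightarrow> ('a \<Rightarrow> complex) set \<Rightarrow> ('a \<Rightarrow> complex) set" where
  "L2_perp \<mu> E = {f \<in> L2 \<mu>. \<forall>u\<in>E. L2_inner \<mu> f u = 0}"

text \<open>Functions are not identified almost everywhere, hence the AE-representative \<open>u\<close>.\<close>

definition L2_closed :: "'a measure \<Rightarrow> ('a \<Rightarrow> complex) set \<Rightarrow> bool" where
  "L2_closed \<mu> E \<longleftrightarrow> E \<subseteq> L2 \<mu> \<and>
     (\<forall>w f. (\<forall>n::nat. w n \<in> E) \<and> f \<in> L2 \<mu> \<and>
        (\<lambda>n. L2_norm \<mu> (\<lambda>x. w n x - f x)) \<longlonglongrightarrow> 0 \<longrightarrow>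
        (\<exists>u\<in>E. AE x in \<mu>. u x = f x))"


section \<open>Sobolev norms on the boundary\<close>

text \<open>Lebesgue measure on the span of a set of basis vectors: \<open>lborel\<close> for \<open>Basis\<close>, and the point
  mass at the origin for the empty set.\<close>

definition lborel_span :: "'a::euclidean_space set \<Rightarrow> 'a measure" where
  "lborel_span B = distr (Pi\<^sub>M B (\<lambda>_. lborel)) borel (\<lambda>x. \<Sum>b\<in>B. x b *\<^sub>R b)"

definition fourier :: "'a::euclidean_space set \<Rightarrow> ('a \<Rightarrow> complex) \<Rightarrow> 'a \<Rightarrow> complex" where
  "fourier B g \<xi> = (LINT y|lborel_span B. cis (- (y \<bullet> \<xi>)) * g y)"

definition flat_Hs :: "real \<Rightarrow> 'a::euclidean_space set \<Rightarrow> ('a \<Rightarrow> complex) set" where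
  "flat_Hs s B = {g. integrable (lborel_span B) g \<and>
     integrable (lborel_span B) (\<lambda>\<xi>. (1 + (norm \<xi>)\<^sup>2) powr s * (cmod (fourier B g \<xi>))\<^sup>2)}"

definition flat_Hs_norm :: "real \<Rightarrow> 'a::euclidean_space set \<Rightarrow> ('a \<Rightarrow> complex) \<Rightarrow> real" where
  "flat_Hs_norm s B g =
     sqrt ((LINT \<xi>|lborel_span B. (1 + (norm \<xi>)\<^sup>2) powr s * (cmod (fourier B g \<xi>))\<^sup>2)
           / (2 * pi) ^ card B)"

definition localise ::
    "'a::euclidean_space bchart \<Rightarrow> ('a \<Rightarrow> complex) \<Rightarrow> 'a \<Rightarrow> complex" where
  "localise c f y =
     (if y \<in> tgt c then complex_of_real (cutoff c (bwd c y)) * f (bwd c y) else 0)"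

definition atlas_Hs :: "'a::euclidean_space bchart set \<Rightarrow> real \<Rightarrow> ('a \<Rightarrow> complex) set" where
  "atlas_Hs \<A> s = {f. \<forall>c\<in>\<A>. localise c f \<in> flat_Hs s (tang c)}"

definition atlas_Hs_norm ::
    "'a::euclidean_space bchart set \<Rightarrow> real \<Rightarrow> ('a \<Rightarrow> complex) \<Rightarrow> real" where
  "atlas_Hs_norm \<A> s f = sqrt (\<Sum>c\<in>\<A>. (flat_Hs_norm s (tang c) (localise c f))\<^sup>2)"

text \<open>
  For negative order, \<open>H^s\<close> is the dual of \<open>H^{-s}\<close> with respect to the \<open>L^2\<close> pairing on the
  boundary; only the functions in it are needed here. The continuous functions in \<open>H^{-s}\<close> are
  dense in it, and the pairing with them is defined for every integrable function.
  On a boundary of class \<open>C^{k,1}\<close> the space is independent of the atlas, and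
  the norm is so up to equivalence, for \<open>\<bar>s\<bar> \<le> k + 1\<close>.
\<close>

definition dual_pairings ::
    "nat \<Rightarrow> 'a::euclidean_space set \<Rightarrow> 'a bchart set \<Rightarrow> real \<Rightarrow> ('a \<Rightarrow> complex) \<Rightarrow> real set" where
  "dual_pairings m S \<A> s f =
     (\<lambda>\<phi>. cmod (L2_inner (restrict_space (hausdorff_measure (m - 1)) (bd S)) f \<phi>)) `
       {\<phi> \<in> atlas_Hs \<A> (- s). continuous_on (bd S) \<phi> \<and> atlas_Hs_norm \<A> (- s) \<phi> \<le> 1}"

definition boundary_Hs ::
    "nat \<Rightarrow> 'a::euclidean_space set \<Rightarrow> 'a bchart set \<Rightarrow> real \<Rightarrow> ('a \<Rightarrow> complex) set" where
  "boundary_Hs m S \<A> s =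
     (if s \<ge> 0 then atlas_Hs \<A> s
      else {f. integrable (restrict_space (hausdorff_measure (m - 1)) (bd S)) f \<and>
               bdd_above (dual_pairings m S \<A> s f)})"

definition boundary_Hs_norm ::
    "nat \<Rightarrow> 'a::euclidean_space set \<Rightarrow> 'a bchart set \<Rightarrow> real \<Rightarrow> ('a \<Rightarrow> complex) \<Rightarrow> real" where
  "boundary_Hs_norm m S \<A> s f =
     (if s \<ge> 0 then atlas_Hs_norm \<A> s f else Sup (dual_pairings m S \<A> s f))"


section \<open>The eigenvalue problem\<close>

text \<open>
  Solutions are of class \<open>C^q\<close> in \<open>S\<close>; for the boundary condition, which involves derivatives up to
  order \<open>q'\<close>, and for the values at points of the boundary to make sense they are moreover
  \<open>C^{q'}\<close> up to the boundary.
\<close>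

definition eigenvalues ::
    "nat \<Rightarrow> nat \<Rightarrow> 'a::euclidean_space set \<Rightarrow> (('a \<Rightarrow> complex) \<Rightarrow> 'a \<Rightarrow> complex) \<Rightarrow>
     (('a \<Rightarrow> complex) \<Rightarrow> 'a \<Rightarrow> complex) \<Rightarrow> nat \<Rightarrow> (nat \<Rightarrow> 'a) \<Rightarrow> (nat \<Rightarrow> complex) \<Rightarrow> complex set" where
  "eigenvalues q q' S F G Na a b =
     {l. \<exists>u. Ck_on q S u \<and> Ck_on q' (closure S) u \<and> (\<exists>x\<in>closure S. u x \<noteq> 0) \<and>
        (\<forall>x\<in>S. F u x - l * u x = 0) \<and> (\<forall>x\<in>bd S. G u x = 0) \<and> (\<forall>j\<in>{1..Na}. u (a j) = b j)}"

definition admissible :: "complex set \<Rightarrow> complex \<Rightarrow> complex \<Rightarrow> bool" where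
  "admissible E lk l \<longleftrightarrow> (\<forall>\<mu>\<in>E. \<mu> \<noteq> lk \<longrightarrow> cmod (l - lk) < cmod (l - \<mu>))"

definition CqG ::
    "nat \<Rightarrow> 'a::euclidean_space set \<Rightarrow> (('a \<Rightarrow> complex) \<Rightarrow> 'a \<Rightarrow> complex) \<Rightarrow> ('a \<Rightarrow> complex) set" where
  "CqG q S G = {u. Ck_on q (closure S) u \<and> (\<forall>x\<in>bd S. G u x = 0)}"

definition eigenspace ::
    "nat \<Rightarrow> 'a::euclidean_space set \<Rightarrow> (('a \<Rightarrow> complex) \<Rightarrow> 'a \<Rightarrow> complex) \<Rightarrow>
     (('a \<Rightarrow> complex) \<Rightarrow> 'a \<Rightarrow> complex) \<Rightarrow> complex \<Rightarrow> ('a \<Rightarrow> complex) set" where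
  "eigenspace q S F G l = {u \<in> CqG q S G. \<forall>x\<in>S. F u x - l * u x = 0}"


section \<open>The discrete problem\<close>

definition hnorm :: "('f \<Rightarrow> 'f \<Rightarrow> complex) \<Rightarrow> 'f \<Rightarrow> real" where
  "hnorm ip f = sqrt (Re (ip f f))"

text \<open>Functions on \<open>\<Omega>\<close> are represented by total functions that vanish outside \<open>\<Omega>\<close>.\<close>

definition hilbert_function_space ::
    "'a set \<Rightarrow> ('a \<Rightarrow> complex) set \<Rightarrow> (('a \<Rightarrow> complex) \<Rightarrow> ('a \<Rightarrow> complex) \<Rightarrow> complex) \<Rightarrow> bool" where
  "hilbert_function_space \<Omega> H ip \<longleftrightarrow>
     (\<forall>f\<in>H. \<forall>x. x \<notin> \<Omega> \<longrightarrow> f x = 0) \<and>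
     (\<lambda>x. 0) \<in> H \<and>
     (\<forall>f\<in>H. \<forall>g\<in>H. (\<lambda>x. f x + g x) \<in> H) \<and>
     (\<forall>c. \<forall>f\<in>H. (\<lambda>x. c * f x) \<in> H) \<and>
     (\<forall>f\<in>H. \<forall>g\<in>H. \<forall>h\<in>H. ip (\<lambda>x. f x + g x) h = ip f h + ip g h) \<and>
     (\<forall>c. \<forall>f\<in>H. \<forall>g\<in>H. ip (\<lambda>x. c * f x) g = c * ip f g) \<and>
     (\<forall>f\<in>H. \<forall>g\<in>H. ip g f = cnj (ip f g)) \<and>
     (\<forall>f\<in>H. Re (ip f f) \<ge> 0 \<and> (ip f f = 0 \<longrightarrow> f = (\<lambda>x. 0))) \<and>
     (\<forall>w. (\<forall>n::nat. w n \<in> H) \<and>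
        (\<forall>e>0. \<exists>N. \<forall>i\<ge>N. \<forall>j\<ge>N. hnorm ip (\<lambda>x. w i x - w j x) < e) \<longrightarrow>
        (\<exists>f\<in>H. (\<lambda>n. hnorm ip (\<lambda>x. w n x - f x)) \<longlonglongrightarrow> 0))"

definition fill_distance :: "'a::euclidean_space set \<Rightarrow> 'a set \<Rightarrow> real" where
  "fill_distance D X = (SUP p\<in>D. Min ((\<lambda>z. norm (p - z)) ` X))"

definition h_max ::
    "'a::euclidean_space set \<Rightarrow> (nat \<Rightarrow> 'a) \<Rightarrow> (nat \<Rightarrow> 'a) \<Rightarrow> nat \<Rightarrow> nat \<Rightarrow> real" where
  "h_max S x y N Nb =
     max (fill_distance S (x ` {1..N})) (fill_distance (bd S) (y ` {1..Nb}))"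

definition point_sequences ::
    "'a::euclidean_space set \<Rightarrow> (nat \<Rightarrow> 'a) \<Rightarrow> (nat \<Rightarrow> 'a) \<Rightarrow> bool" where
  "point_sequences S x y \<longleftrightarrow>
     (\<forall>j\<ge>1. x j \<in> S) \<and> (\<forall>j\<ge>1. y j \<in> bd S) \<and>
     ((\<lambda>(N, Nb). h_max S x y N Nb) \<longlongrightarrow> 0) (sequentially \<times>\<^sub>F sequentially)"

definition discrete_solution ::
    "('a \<Rightarrow> complex) set \<Rightarrow> (('a \<Rightarrow> complex) \<Rightarrow> ('a \<Rightarrow> complex) \<Rightarrow> complex) \<Rightarrow>
     (('a \<Rightarrow> complex) \<Rightarrow> 'a \<Rightarrow> complex) \<Rightarrow> (('a \<Rightarrow> complex) \<Rightarrow> 'a \<Rightarrow> complex) \<Rightarrow>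
     nat \<Rightarrow> (nat \<Rightarrow> 'a) \<Rightarrow> (nat \<Rightarrow> complex) \<Rightarrow> (nat \<Rightarrow> 'a) \<Rightarrow> (nat \<Rightarrow> 'a) \<Rightarrow> nat \<Rightarrow> nat \<Rightarrow>
     complex \<Rightarrow> ('a \<Rightarrow> complex) \<Rightarrow> bool" where
  "discrete_solution H ip F G Na a b x y N Nb l =
     is_arg_min (hnorm ip) (\<lambda>u. u \<in> H \<and>
       (\<forall>j\<in>{1..N}. F u (x j) - l * u (x j) = 0) \<and>
       (\<forall>j\<in>{1..Nb}. G u (y j) = 0) \<and>
       (\<forall>j\<in>{1..Na}. u (a j) = b j))"

end

theory Submission
  imports Defs
begin

text \<open>
  Correct the discrete solution \<open>u\<close> by the function \<open>g\<close> of assumption (1) with the same boundary data: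
  \<open>w = u - g\<close> satisfies the boundary condition, and \<open>(F - \<lambda>) w\<close> is the residual of \<open>u\<close> plus a multiple
  of the small function \<open>g\<close>. Split \<open>w = v + z\<close> with \<open>v\<close> in the eigenspace and \<open>z\<close> orthogonal to it.
  Then \<open>(F - \<lambda>) w = (F - \<lambda>) z + (\<lambda>\<^sub>k - \<lambda>) v\<close>, and by (5) the two summands are almost orthogonal, so
  each is bounded by \<open>(1 - \<theta>)^{-1/2}\<close> times the norm of the sum. The first bounds
  \<open>z\<close> by (4), hence \<open>u - v = z + g\<close>; the second bounds \<open>\<bar>\<lambda> - \<lambda>\<^sub>k\<bar> \<parallel>v\<parallel>\<close>, and \<open>v\<close> is bounded below since \<open>u\<close> is.
\<close>

section \<open>Linearity of differential operators\<close>

text \<open>Assumptions (4) and (5) speak only of \<open>C^q\<close> functions with zero boundary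
  data, so the projection has to be an actual function and not a class modulo null sets. As
  \<open>Nk\<close> consists of functions in \<open>CqG\<close>, the remainder
  \<open>z = w - v\<close> inherits regularity and boundary condition from \<open>w\<close>. The
  projection exists by closedness (3) and completeness of \<open>L^2\<close>. Completeness is proved
  for finite measures, and square integrability of functions continuous on \<open>closure S\<close>
  also rests on finiteness; this is why coverings of \<open>S\<close> are counted. Square
  integrability of \<open>(F - \<lambda>) z\<close> has no such source, since \<open>F z\<close> is
  known to be continuous only inside \<open>S\<close>. It is read off the identity that expresses it
  by the residual of \<open>u\<close>, by \<open>g\<close> and by \<open>v\<close>. As
  \<open>(F - \<alpha>) g = 0\<close>, the multiple of \<open>g\<close> is
  \<open>\<lambda> - \<alpha>\<close>, of modulus at most the distance from \<open>\<alpha>\<close>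
  to the eigenvalue plus the distance from \<open>\<lambda>\<close> to it. The second part produces
  the eigenvalue error on the right of the estimates. One factor \<open>hnorm ip u\<close> in them
  comes from the residual bounds, the other from the lower bound for \<open>u\<close>.\<close>

lemma has_derivative_cong_open:
  assumes "open U" "x \<in> U" "\<And>z. z \<in> U \<Longrightarrow> f z = g z"
  shows "(f has_derivative f') (at x) \<longleftrightarrow> (g has_derivative f') (at x)"
  using assms has_derivative_transform_within_open[of f f' x UNIV U g]
    has_derivative_transform_within_open[of g f' x UNIV U f] by auto

lemma partial_deriv_cong:
  assumes "open U" "x \<in> U" "\<And>z. z \<in> U \<Longrightarrow> f z = g z"
  shows "partial_deriv b f x = partial_deriv b g x"
  unfolding partial_deriv_def frechet_derivative_def
  by (simp add: has_derivative_cong_open[OF assms])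

lemma differentiable_cong_open:
  assumes "open U" "x \<in> U" "\<And>z. z \<in> U \<Longrightarrow> f z = g z"
  shows "f differentiable (at x) \<longleftrightarrow> g differentiable (at x)"
  unfolding differentiable_def by (simp add: has_derivative_cong_open[OF assms])

text \<open>Derivatives at points of an open set depend on the values in that set only. The
  recursion in \<open>Ck_open\<close> differentiates total functions, whose derivatives off
  \<open>U\<close> are uncontrolled, so identities have to be passed on as identities on
  \<open>U\<close>.\<close>

lemma Ck_open_cong:
  assumes "open U" "\<And>z. z \<in> U \<Longrightarrow> f z = g z"
  shows "Ck_open k U f \<longleftrightarrow> Ck_open k U g"
  using assms(2)
proof (induction k arbitrary: f g)
  case 0
  then show ?case by (simp cong: continuous_on_cong)
next
  case (Suc k)
  have "Ck_open k U (partial_deriv b f) \<longleftrightarrow> Ck_open k U (partial_deriv b g)" for b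
    using partial_deriv_cong[OF \<open>open U\<close>, of _ f g] Suc.prems by (intro Suc.IH) blast
  moreover have "f differentiable (at x) \<longleftrightarrow> g differentiable (at x)" if "x \<in> U" for x
    using differentiable_cong_open[OF \<open>open U\<close> that, of f g] Suc.prems by blast
  ultimately show ?case by simp
qed

lemma Ck_open_Suc_imp: "open U \<Longrightarrow> Ck_open (Suc k) U f \<Longrightarrow> Ck_open k U f"
proof (induction k arbitrary: f)
  case 0
  then show ?case
    using differentiable_imp_continuous_within
    by (force intro: continuous_at_imp_continuous_on)
next
  case (Suc k)
  have "Ck_open k U (partial_deriv b f)" if "b \<in> Basis" for b
    using Suc.IH[OF Suc.prems(1), of "partial_deriv b f"] Suc.prems(2) that by auto
  then show ?case using Suc.prems(2) by auto
qed

lemma Ck_open_mono: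
  assumes "open U" "j \<le> k" "Ck_open k U f"
  shows "Ck_open j U f"
  using assms(2,1,3)
proof (induction rule: dec_induct)
  case (step n)
  then show ?case using Ck_open_Suc_imp by blast
qed

lemma Ck_open_subset: "V \<subseteq> U \<Longrightarrow> Ck_open k U f \<Longrightarrow> Ck_open k V f"
  by (induction k arbitrary: f) (auto intro: continuous_on_subset)

lemma partial_deriv_lincomb:
  fixes f g :: "'a::euclidean_space \<Rightarrow> complex"
  assumes "f differentiable (at x)" "g differentiable (at x)"
  shows "partial_deriv b (\<lambda>z. f z + c * g z) x = partial_deriv b f x + c * partial_deriv b g x"
proof -
  have "((\<lambda>z. f z + c * g z) has_derivative
      (\<lambda>h. frechet_derivative f (at x) h + c * frechet_derivative g (at x) h)) (at x)"
    using assms unfolding frechet_derivative_works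
    by (auto intro!: derivative_eq_intros)
  then show ?thesis
    unfolding partial_deriv_def by (simp add: frechet_derivative_at[symmetric])
qed

lemma Ck_open_lincomb:
  fixes f g :: "'a::euclidean_space \<Rightarrow> complex"
  assumes "open U" "Ck_open k U f" "Ck_open k U g"
  shows "Ck_open k U (\<lambda>z. f z + c * g z)"
  using assms(2,3)
proof (induction k arbitrary: f g)
  case 0
  then show ?case by (auto intro!: continuous_intros)
next
  case (Suc k)
  have "Ck_open k U (partial_deriv b (\<lambda>z. f z + c * g z))" if "b \<in> Basis" for b
  proof -
    have "Ck_open k U (\<lambda>z. partial_deriv b f z + c * partial_deriv b g z)"
      using Suc that by auto
    then show ?thesis
      using Ck_open_cong[OF \<open>open U\<close>, of "partial_deriv b (\<lambda>z. f z + c * g z)"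
          "\<lambda>z. partial_deriv b f z + c * partial_deriv b g z" k] Suc.prems
      by (auto intro: partial_deriv_lincomb)
  qed
  moreover have "(\<lambda>z. f z + c * g z) differentiable (at x)" if "x \<in> U" for x
    using Suc.prems that by (auto intro!: derivative_intros)
  ultimately show ?case by simp
qed

text \<open>\<open>foldr\<close> applies the last entry of the list first. Lists are therefore
  peeled from the end: the innermost derivative lowers the order by one, and the induction
  hypothesis applies to the differentiated functions.\<close>

lemma iter_partial_snoc: "iter_partial (bs @ [b]) g = iter_partial bs (partial_deriv b g)"
  by (simp add: iter_partial_def)

lemma iter_partial_cong:
  assumes "open U" "\<And>z. z \<in> U \<Longrightarrow> f z = g z" "x \<in> U"
  shows "iter_partial bs f x = iter_partial bs g x"
  using assms(2,3)
proof (induction bs arbitrary: f g x rule: rev_induct)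
  case Nil
  then show ?case by (simp add: iter_partial_def)
next
  case (snoc b bs)
  show ?case unfolding iter_partial_snoc
    using partial_deriv_cong[OF \<open>open U\<close>, of _ f g] snoc.prems by (intro snoc.IH) auto
qed

lemma iter_partial_lincomb:
  fixes f g :: "'a::euclidean_space \<Rightarrow> complex"
  assumes "open U" "Ck_open k U f" "Ck_open k U g" "x \<in> U" "set bs \<subseteq> Basis" "length bs \<le> k"
  shows "iter_partial bs (\<lambda>z. f z + c * g z) x = iter_partial bs f x + c * iter_partial bs g x"
  using assms(2-)
proof (induction bs arbitrary: f g k rule: rev_induct)
  case Nil
  then show ?case by (simp add: iter_partial_def)
next
  case (snoc b bs)
  then obtain j where k: "k = Suc j" by (cases k) auto
  have "iter_partial bs (partial_deriv b (\<lambda>z. f z + c * g z)) x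
      = iter_partial bs (\<lambda>z. partial_deriv b f z + c * partial_deriv b g z) x"
    using snoc.prems k by (intro iter_partial_cong[OF \<open>open U\<close>] partial_deriv_lincomb) auto
  also have "\<dots> = iter_partial bs (partial_deriv b f) x + c * iter_partial bs (partial_deriv b g) x"
    using snoc.prems k by (intro snoc.IH[of j]) auto
  finally show ?case by (simp add: iter_partial_snoc)
qed

section \<open>Functions of class \<open>C^k\<close> on arbitrary sets\<close>

lemma Ck_on_mono: "j \<le> k \<Longrightarrow> Ck_on k X u \<Longrightarrow> Ck_on j X u"
  unfolding Ck_on_def by (meson Ck_open_mono)

text \<open>A single neighbourhood for both functions allows their extensions to be added.\<close>

lemma Ck_on_common_extension:
  assumes "Ck_on k X u" "Ck_on k X v" "x \<in> X"
  obtains U f g where "open U" "x \<in> U" "Ck_open k U f" "Ck_open k U g"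
    "\<And>z. z \<in> X \<inter> U \<Longrightarrow> u z = f z" "\<And>z. z \<in> X \<inter> U \<Longrightarrow> v z = g z"
proof -
  obtain U f where U: "open U" "x \<in> U" "Ck_open k U f" "\<And>z. z \<in> X \<inter> U \<Longrightarrow> u z = f z"
    using assms unfolding Ck_on_def by metis
  obtain V g where V: "open V" "x \<in> V" "Ck_open k V g" "\<And>z. z \<in> X \<inter> V \<Longrightarrow> v z = g z"
    using assms unfolding Ck_on_def by metis
  show ?thesis
    by (rule that[of "U \<inter> V" f g])
      (use U V in \<open>auto intro: Ck_open_subset[of _ U] Ck_open_subset[of _ V]\<close>)
qed

lemma Ck_on_lincomb:
  assumes "Ck_on k X u" "Ck_on k X v"
  shows "Ck_on k X (\<lambda>z. u z + c * v z)"
  unfolding Ck_on_def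
proof
  fix x assume "x \<in> X"
  then obtain U f g where U: "open U" "x \<in> U" "Ck_open k U f" "Ck_open k U g"
    "\<And>z. z \<in> X \<inter> U \<Longrightarrow> u z = f z" "\<And>z. z \<in> X \<inter> U \<Longrightarrow> v z = g z"
    using Ck_on_common_extension[OF assms] by metis
  then show "\<exists>U h. open U \<and> x \<in> U \<and> Ck_open k U h \<and> (\<forall>z\<in>X \<inter> U. u z + c * v z = h z)"
    by (intro exI[of _ U] exI[of _ "\<lambda>z. f z + c * g z"]) (auto intro: Ck_open_lincomb)
qed

lemma Ck_on_imp_continuous_on:
  assumes "Ck_on k X u"
  shows "continuous_on X u"
  unfolding continuous_on_eq_continuous_within
proof
  fix x assume x: "x \<in> X"
  then obtain U g where U: "open U" "x \<in> U" "Ck_open k U g" "\<forall>z\<in>X \<inter> U. u z = g z"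
    using assms unfolding Ck_on_def by metis
  then have "continuous_on U g" using Ck_open_mono[of U 0 k g] by simp
  then have "continuous_on (X \<inter> U) u"
    using U by (metis continuous_on_cong continuous_on_subset inf_le2)
  then have "continuous (at x within (X \<inter> U)) u"
    using x U by (simp add: continuous_on_eq_continuous_within)
  moreover have "at x within (X \<inter> U) = at x within X"
    using U x by (intro at_within_nhd[of x U]) auto
  ultimately show "continuous (at x within X) u" by (simp add: continuous_within)
qed

text \<open>Linearity is not stated in \<open>differential_operator\<close>. It follows because the
  coefficients are the same for all functions and any extension may be used: the combination of two
  extensions extends the combination.\<close>

lemma differential_operator_lincomb:
  assumes P: "differential_operator k X Y P" and "Y \<subseteq> X"
    and u: "Ck_on k X u" and v: "Ck_on k X v" and x: "x \<in> Y"
  shows "P (\<lambda>z. u z + c * v z) x = P u x + c * P v x"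
proof -
  obtain d where d: "\<And>U g u. open U \<Longrightarrow> x \<in> U \<Longrightarrow> Ck_open k U g \<Longrightarrow> \<forall>z\<in>X \<inter> U. u z = g z \<Longrightarrow>
     P u x = (\<Sum>bs | set bs \<subseteq> Basis \<and> length bs \<le> k. d bs x * iter_partial bs g x)"
  proof -
    from P obtain d where "\<forall>x\<in>Y. \<forall>U g u. open U \<and> x \<in> U \<and> Ck_open k U g \<and> (\<forall>z\<in>X \<inter> U. u z = g z) \<longrightarrow>
          P u x = (\<Sum>bs | set bs \<subseteq> Basis \<and> length bs \<le> k. d bs x * iter_partial bs g x)"
      unfolding differential_operator_def by (elim exE)
    then show ?thesis using x by (intro that[of d]) blast
  qed
  obtain U f g where U: "open U" "x \<in> U" "Ck_open k U f" "Ck_open k U g"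
    "\<And>z. z \<in> X \<inter> U \<Longrightarrow> u z = f z" "\<And>z. z \<in> X \<inter> U \<Longrightarrow> v z = g z"
    by (rule Ck_on_common_extension[OF u v subsetD[OF \<open>Y \<subseteq> X\<close> x]]) (rule that)
  have uv: "\<forall>z\<in>X \<inter> U. u z + c * v z = f z + c * g z" using U(5,6) by simp
  have "P (\<lambda>z. u z + c * v z) x =
      (\<Sum>bs | set bs \<subseteq> Basis \<and> length bs \<le> k. d bs x * iter_partial bs (\<lambda>z. f z + c * g z) x)"
    by (rule d[OF U(1,2) Ck_open_lincomb[OF U(1,3,4)] uv])
  also have "\<dots> = (\<Sum>bs | set bs \<subseteq> Basis \<and> length bs \<le> k.
      d bs x * iter_partial bs f x + c * (d bs x * iter_partial bs g x))"
    using iter_partial_lincomb[OF U(1,3,4,2)]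
    by (intro sum.cong refl) (simp add: ring_distribs mult.left_commute)
  also have "\<dots> = P u x + c * P v x"
    using d[OF U(1,2,3)] d[OF U(1,2,4)] U(5,6) by (simp add: sum.distrib sum_distrib_left)
  finally show ?thesis .
qed

section \<open>Finiteness of the Hausdorff measure\<close>

text \<open>\<open>X\<close> has upper box dimension at most \<open>m\<close> with finite \<open>m\<close>-dimensional content: this passes to
  finite unions and Lipschitz images, and it bounds the Hausdorff measure without
  any use of its countable subadditivity.\<close>

definition box_covered :: "nat \<Rightarrow> 'a::euclidean_space set \<Rightarrow> bool" where
  "box_covered m X \<longleftrightarrow> (\<exists>K\<ge>0. \<forall>n\<ge>1::nat. \<exists>\<C>. finite \<C> \<and> real (card \<C>) \<le> K * real n ^ m \<and>
     (\<forall>D\<in>\<C>. \<forall>x\<in>D. \<forall>y\<in>D. dist x y \<le> K / real n) \<and> X \<subseteq> \<Union>\<C>)"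

lemma box_covered_subset: "box_covered m X \<Longrightarrow> Y \<subseteq> X \<Longrightarrow> box_covered m Y"
  unfolding box_covered_def by (meson order_trans)

lemma box_covered_empty: "box_covered m {}"
  unfolding box_covered_def by (intro exI[of _ 0]) (auto intro: exI[of _ "{}"])

lemma box_covered_Un:
  assumes "box_covered m X" "box_covered m Y"
  shows "box_covered m (X \<union> Y)"
proof -
  obtain K where K: "K \<ge> 0" "\<And>n::nat. n \<ge> 1 \<Longrightarrow> \<exists>\<C>. finite \<C> \<and> real (card \<C>) \<le> K * real n ^ m \<and>
     (\<forall>D\<in>\<C>. \<forall>x\<in>D. \<forall>y\<in>D. dist x y \<le> K / real n) \<and> X \<subseteq> \<Union>\<C>"
    using assms(1) unfolding box_covered_def by blast
  obtain L where L: "L \<ge> 0" "\<And>n::nat. n \<ge> 1 \<Longrightarrow> \<exists>\<C>. finite \<C> \<and> real (card \<C>) \<le> L * real n ^ m \<and>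
     (\<forall>D\<in>\<C>. \<forall>x\<in>D. \<forall>y\<in>D. dist x y \<le> L / real n) \<and> Y \<subseteq> \<Union>\<C>"
    using assms(2) unfolding box_covered_def by blast
  have "\<exists>\<C>. finite \<C> \<and> real (card \<C>) \<le> (K + L) * real n ^ m \<and>
     (\<forall>D\<in>\<C>. \<forall>x\<in>D. \<forall>y\<in>D. dist x y \<le> (K + L) / real n) \<and> X \<union> Y \<subseteq> \<Union>\<C>" if n: "n \<ge> 1" for n :: nat
  proof -
    obtain \<C> where C: "finite \<C>" "real (card \<C>) \<le> K * real n ^ m"
      "\<forall>D\<in>\<C>. \<forall>x\<in>D. \<forall>y\<in>D. dist x y \<le> K / real n" "X \<subseteq> \<Union>\<C>" using K(2)[OF n] by blast
    obtain \<D> where D: "finite \<D>" "real (card \<D>) \<le> L * real n ^ m"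
      "\<forall>D\<in>\<D>. \<forall>x\<in>D. \<forall>y\<in>D. dist x y \<le> L / real n" "Y \<subseteq> \<Union>\<D>" using L(2)[OF n] by blast
    have "real (card (\<C> \<union> \<D>)) \<le> real (card \<C>) + real (card \<D>)"
      using card_Un_le[of \<C> \<D>] by linarith
    also have "\<dots> \<le> (K + L) * real n ^ m" using C(2) D(2) by (simp add: algebra_simps)
    finally have "real (card (\<C> \<union> \<D>)) \<le> (K + L) * real n ^ m" .
    moreover have "K / real n \<le> (K + L) / real n" "L / real n \<le> (K + L) / real n"
      using K(1) L(1) by (auto intro!: divide_right_mono)
    then have "\<forall>D\<in>\<C> \<union> \<D>. \<forall>x\<in>D. \<forall>y\<in>D. dist x y \<le> (K + L) / real n"
      using C(3) D(3) by (meson UnE order_trans)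
    ultimately show ?thesis
      using C D by (intro exI[of _ "\<C> \<union> \<D>"]) auto
  qed
  then show ?thesis
    unfolding box_covered_def using K(1) L(1) by (intro exI[of _ "K + L"]) auto
qed

lemma box_covered_UN:
  "finite I \<Longrightarrow> (\<And>i. i \<in> I \<Longrightarrow> box_covered m (X i)) \<Longrightarrow> box_covered m (\<Union>i\<in>I. X i)"
  by (induction I rule: finite_induct) (auto intro: box_covered_Un box_covered_empty)

lemma box_covered_lipschitz_image:
  fixes f :: "'a::euclidean_space \<Rightarrow> 'b::euclidean_space"
  assumes "box_covered m X" "L-lipschitz_on X f"
  shows "box_covered m (f ` X)"
proof -
  obtain K where K: "K \<ge> 0" "\<And>n::nat. n \<ge> 1 \<Longrightarrow> \<exists>\<C>. finite \<C> \<and> real (card \<C>) \<le> K * real n ^ m \<and>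
     (\<forall>D\<in>\<C>. \<forall>x\<in>D. \<forall>y\<in>D. dist x y \<le> K / real n) \<and> X \<subseteq> \<Union>\<C>"
    using assms(1) unfolding box_covered_def by blast
  have L: "L \<ge> 0" using assms(2) lipschitz_on_nonneg by blast
  \<comment> \<open>The factor \<open>1 + L\<close> instead of \<open>L\<close>: the same constant
    must also bound the number of pieces, which does not shrink when \<open>L < 1\<close>.\<close>
  have "\<exists>\<C>. finite \<C> \<and> real (card \<C>) \<le> ((1 + L) * K) * real n ^ m \<and>
     (\<forall>D\<in>\<C>. \<forall>x\<in>D. \<forall>y\<in>D. dist x y \<le> ((1 + L) * K) / real n) \<and> f ` X \<subseteq> \<Union>\<C>"
    if n: "n \<ge> 1" for n :: nat
  proof -
    obtain \<C> where C: "finite \<C>" "real (card \<C>) \<le> K * real n ^ m"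
      "\<forall>D\<in>\<C>. \<forall>x\<in>D. \<forall>y\<in>D. dist x y \<le> K / real n" "X \<subseteq> \<Union>\<C>" using K(2)[OF n] by blast
    \<comment> \<open>Pieces may stick out of \<open>X\<close>, where \<open>f\<close> is not known
      to be Lipschitz.\<close>
    let ?\<D> = "(\<lambda>D. f ` (D \<inter> X)) ` \<C>"
    have "K * real n ^ m \<le> ((1 + L) * K) * real n ^ m"
      using K(1) L by (intro mult_right_mono) (auto simp: algebra_simps)
    moreover have "card ?\<D> \<le> card \<C>" using C(1) card_image_le by blast
    ultimately have "real (card ?\<D>) \<le> ((1 + L) * K) * real n ^ m" using C(2) by linarith
    moreover have "dist (f x) (f y) \<le> ((1 + L) * K) / real n"
      if "D \<in> \<C>" "x \<in> D \<inter> X" "y \<in> D \<inter> X" for D x y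
    proof -
      have "dist (f x) (f y) \<le> L * dist x y" using assms(2) that lipschitz_onD by blast
      also have "\<dots> \<le> L * (K / real n)" using C(3) that L by (intro mult_left_mono) auto
      also have "\<dots> \<le> ((1 + L) * K) / real n"
        using K(1) by (simp add: algebra_simps divide_right_mono)
      finally show ?thesis .
    qed
    ultimately show ?thesis
      using C(1,4) by (intro exI[of _ ?\<D>]) fastforce
  qed
  then show ?thesis
    unfolding box_covered_def using K(1) L by (intro exI[of _ "(1 + L) * K"]) auto
qed

text \<open>A cubic grid of mesh \<open>1 / n\<close> in the coordinates from \<open>B\<close> is
  enough, as all other coordinates vanish on \<open>span B\<close>; hence the exponent
  \<open>card B\<close>.\<close>

lemma box_covered_span:
  fixes X :: "'a::euclidean_space set"
  assumes B: "B \<subseteq> Basis" and X: "bounded X" "X \<subseteq> span B"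
  shows "box_covered (card B) X"
proof -
  obtain R0 where R0: "\<And>x. x \<in> X \<Longrightarrow> norm x \<le> R0" using X(1) bounded_iff by metis
  define R where "R = nat \<lceil>R0\<rceil>"
  have R: "norm x \<le> real R" if "x \<in> X" for x
    using R0[OF that] unfolding R_def by linarith
  \<comment> \<open>The first summand pays for the number of grid cells, the second for their
    diameter, estimated by the sum of the coordinate differences.\<close>
  define K where "K = real (2 * R + 1) ^ card B + real DIM('a)"
  have "\<exists>\<C>. finite \<C> \<and> real (card \<C>) \<le> K * real n ^ card B \<and>
     (\<forall>D\<in>\<C>. \<forall>x\<in>D. \<forall>y\<in>D. dist x y \<le> K / real n) \<and> X \<subseteq> \<Union>\<C>"
    if n: "n \<ge> 1" for n :: nat
  proof -
    define idx where "idx = (\<lambda>z::'a. \<lambda>b\<in>B. \<lfloor>real n * (z \<bullet> b)\<rfloor>)"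
    define I where "I = (B \<rightarrow>\<^sub>E {- int (n * R)..int (n * R)})"
    define \<C> where "\<C> = (\<lambda>i. {z \<in> X. idx z = i}) ` I"
    have finB: "finite B" using B finite_Basis finite_subset by blast
    have finI: "finite I" unfolding I_def using finB by (intro finite_PiE) auto
    have "card I = (2 * (n * R) + 1) ^ card B"
      unfolding I_def using finB by (simp add: card_PiE nat_add_distrib nat_mult_distrib mult.commute)
    \<comment> \<open>Since \<open>n \<ge> 1\<close>, the additive 1 is absorbed and the count
      becomes a multiple of a pure power of \<open>n\<close>.\<close>
    moreover have "2 * (n * R) + 1 \<le> (2 * R + 1) * n" using n by (simp add: algebra_simps)
    ultimately have "card I \<le> ((2 * R + 1) * n) ^ card B" by (metis power_mono zero_le)
    moreover have "card \<C> \<le> card I" unfolding \<C>_def using finI card_image_le by blast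
    ultimately have "real (card \<C>) \<le> real (((2 * R + 1) * n) ^ card B)" by linarith
    also have "\<dots> = real (2 * R + 1) ^ card B * real n ^ card B"
      by (simp only: of_nat_power of_nat_mult power_mult_distrib)
    also have "\<dots> \<le> K * real n ^ card B" unfolding K_def by (intro mult_right_mono) auto
    finally have card: "real (card \<C>) \<le> K * real n ^ card B" .
    have diam: "dist x y \<le> K / real n" if x: "x \<in> X" and y: "y \<in> X" and xy: "idx x = idx y" for x y
    proof -
      have "\<bar>(x - y) \<bullet> b\<bar> \<le> 1 / real n" if b: "b \<in> Basis" for b
      proof (cases "b \<in> B")
        case True
        then have "\<lfloor>real n * (x \<bullet> b)\<rfloor> = \<lfloor>real n * (y \<bullet> b)\<rfloor>"
          using xy unfolding idx_def by (metis restrict_apply')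
        then have "\<bar>real n * (x \<bullet> b) - real n * (y \<bullet> b)\<bar> \<le> 1" by linarith
        moreover have "\<bar>real n * (x \<bullet> b) - real n * (y \<bullet> b)\<bar> = real n * \<bar>(x - y) \<bullet> b\<bar>"
          by (simp add: inner_diff_left abs_mult flip: right_diff_distrib)
        ultimately show ?thesis using n by (simp add: field_simps)
      next
        case False
        have "z \<bullet> b = 0" if "z \<in> span B" for z
          using that
        proof (induction rule: span_induct_alt)
          case base
          then show ?case by simp
        next
          case (step c w z)
          then have "w \<bullet> b = 0" using False b B by (metis inner_not_same_Basis subsetD)
          then show ?case using step by (simp add: inner_add_left)
        qed
        then have "x \<bullet> b = 0" "y \<bullet> b = 0" using x y X(2) by blast+
        then show ?thesis by (simp add: inner_diff_left)
      qed
      then have "(\<Sum>b\<in>Basis. \<bar>(x - y) \<bullet> b\<bar>) \<le> (\<Sum>b\<in>(Basis::'a set). 1 / real n)"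
        by (intro sum_mono)
      moreover have "dist x y \<le> (\<Sum>b\<in>Basis. \<bar>(x - y) \<bullet> b\<bar>)"
        unfolding dist_norm by (rule norm_le_l1)
      ultimately have "dist x y \<le> real DIM('a) / real n" by simp
      also have "\<dots> \<le> K / real n" unfolding K_def by (intro divide_right_mono) auto
      finally show ?thesis .
    qed
    have "idx z \<in> I" if z: "z \<in> X" for z
    proof -
      have "\<lfloor>real n * (z \<bullet> b)\<rfloor> \<in> {- int (n * R)..int (n * R)}" if "b \<in> B" for b
      proof -
        have "\<bar>z \<bullet> b\<bar> \<le> real R" using Basis_le_norm[of b z] R[OF z] that B by force
        then have "real n * \<bar>z \<bullet> b\<bar> \<le> real n * real R" by (intro mult_left_mono) auto
        then have "\<bar>real n * (z \<bullet> b)\<bar> \<le> real_of_int (int (n * R))"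
          by (simp add: abs_mult)
        then show ?thesis unfolding atLeastAtMost_iff by linarith
      qed
      then show ?thesis unfolding I_def idx_def by auto
    qed
    then have "X \<subseteq> \<Union>\<C>" unfolding \<C>_def by auto
    moreover have "finite \<C>" unfolding \<C>_def using finI by auto
    ultimately show ?thesis using card diam by (intro exI[of _ \<C>]) (auto simp: \<C>_def)
  qed
  moreover have "K \<ge> 0" unfolding K_def by simp
  ultimately show ?thesis unfolding box_covered_def by blast
qed

text \<open>At scale \<open>1 / n\<close> there are at most \<open>K * n ^ m\<close> pieces, each
  contributing at most \<open>v * (K / n / 2) ^ m\<close>. The powers of \<open>n\<close> cancel, so
  one bound serves every \<open>\<delta>\<close>.\<close>

lemma hausdorff_outer_finite:
  fixes X :: "'a::euclidean_space set"
  assumes "box_covered m X"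
  shows "hausdorff_outer m X < \<infinity>"
proof -
  obtain K where K: "K \<ge> 0" "\<And>n::nat. n \<ge> 1 \<Longrightarrow> \<exists>\<C>. finite \<C> \<and> real (card \<C>) \<le> K * real n ^ m \<and>
     (\<forall>D\<in>\<C>. \<forall>x\<in>D. \<forall>y\<in>D. dist x y \<le> K / real n) \<and> X \<subseteq> \<Union>\<C>"
    using assms unfolding box_covered_def by blast
  define v where "v = unit_ball_vol (real m)"
  have v: "v \<ge> 0" unfolding v_def by simp
  have "hausdorff_pre m \<delta> X \<le> ennreal (K * v * (K / 2) ^ m)" if \<delta>: "\<delta> > 0" for \<delta>
  proof -
    \<comment> \<open>\<open>Suc\<close> keeps \<open>n\<close> positive also for
      \<open>K = 0\<close>.\<close>
    define n where "n = Suc (nat \<lceil>K / \<delta>\<rceil>)"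
    have "K / \<delta> \<le> real n" unfolding n_def by linarith
    then have n: "n \<ge> 1" "K / real n \<le> \<delta>" using \<delta> by (auto simp: n_def field_simps)
    obtain \<C> where C: "finite \<C>" "real (card \<C>) \<le> K * real n ^ m"
      "\<forall>D\<in>\<C>. \<forall>x\<in>D. \<forall>y\<in>D. dist x y \<le> K / real n" "X \<subseteq> \<Union>\<C>" using K(2)[OF n(1)] by blast
    obtain h where h: "bij_betw h {0..<card \<C>} \<C>" using ex_bij_betw_nat_finite[OF C(1)] by blast
    \<comment> \<open>The finite cover is padded with empty sets, which \<open>hausdorff_pre\<close>
      counts as 0 even for \<open>m = 0\<close>, where the power alone would be 1.\<close>
    define D where "D = (\<lambda>i. if i < card \<C> then h i else {})"
    have Kn: "K / real n \<ge> 0" using K(1) by simp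
    have Ddist: "dist x y \<le> K / real n" if "x \<in> D i" "y \<in> D i" for x y i
    proof -
      have "D i \<in> \<C>" using that(1) h by (auto simp: D_def bij_betw_def split: if_splits)
      then show ?thesis using that C(3) by blast
    qed
    have diam: "diameter (D i) \<le> K / real n" for i
      by (rule diameter_le) (use Ddist Kn in \<open>auto simp: dist_norm\<close>)
    have bdd: "bounded (D i)" for i
      using Ddist[of _ i] unfolding bounded_two_points by blast
    have cover: "X \<subseteq> (\<Union>i. D i)"
    proof
      fix x assume "x \<in> X"
      then obtain E where "x \<in> E" "E \<in> \<C>" using C(4) by blast
      then obtain i where "i < card \<C>" "h i = E"
        using bij_betw_imp_surj_on[OF h] by (metis atLeastLessThan_iff imageE)
      then show "x \<in> (\<Union>i. D i)" using \<open>x \<in> E\<close> by (intro UN_I[of i]) (auto simp: D_def)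
    qed
    have "hausdorff_pre m \<delta> X \<le>
      (\<Sum>i. if D i = {} then 0 else ennreal (v * (diameter (D i) / 2) ^ m))"
      unfolding hausdorff_pre_def v_def
      by (intro INF_lower) (use bdd diam n(2) cover in \<open>auto intro: order_trans\<close>)
    also have "\<dots> = (\<Sum>i\<in>{..<card \<C>}. if D i = {} then 0 else ennreal (v * (diameter (D i) / 2) ^ m))"
      by (intro suminf_finite) (auto simp: D_def)
    also have "\<dots> \<le> (\<Sum>i\<in>{..<card \<C>}. ennreal (v * (K / real n / 2) ^ m))"
    proof (intro sum_mono)
      fix i
      have "v * (diameter (D i) / 2) ^ m \<le> v * (K / real n / 2) ^ m"
        using diam[of i] diameter_ge_0[OF bdd, of i] v
        by (intro mult_left_mono power_mono) auto
      then show "(if D i = {} then 0 else ennreal (v * (diameter (D i) / 2) ^ m))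
          \<le> ennreal (v * (K / real n / 2) ^ m)" by (auto intro: ennreal_leI)
    qed
    also have "\<dots> = ennreal (real (card \<C>) * (v * (K / real n / 2) ^ m))"
      by (simp add: ennreal_mult' ennreal_of_nat_eq_real_of_nat)
    also have "\<dots> \<le> ennreal (K * real n ^ m * (v * (K / real n / 2) ^ m))"
      using C(2) v Kn by (intro ennreal_leI mult_right_mono) auto
    also have "K * real n ^ m * (v * (K / real n / 2) ^ m) = K * v * (K / 2) ^ m"
      using n(1) by (simp add: power_divide)
    finally show ?thesis .
  qed
  then have "hausdorff_outer m X \<le> ennreal (K * v * (K / 2) ^ m)"
    unfolding hausdorff_outer_def by (intro SUP_least) auto
  then show ?thesis using le_less_trans by fastforce
qed

section \<open>Coverings of embedded manifolds through their charts\<close>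

lemma Ck_open_1_imp_lipschitz:
  fixes g :: "'a::euclidean_space \<Rightarrow> 'b::euclidean_space"
  assumes "Ck_open 1 V g" "compact C" "convex C" "C \<subseteq> V"
  obtains L where "L-lipschitz_on C g"
proof -
  have "\<exists>K. \<forall>x\<in>C. norm (partial_deriv b g x) \<le> K" if "b \<in> Basis" for b
  proof -
    have "continuous_on C (partial_deriv b g)"
      using assms that by (auto intro: continuous_on_subset)
    then have "bounded (partial_deriv b g ` C)"
      using assms(2) compact_continuous_image compact_imp_bounded by blast
    then show ?thesis unfolding bounded_iff by auto
  qed
  then obtain K where K: "\<And>b x. b \<in> Basis \<Longrightarrow> x \<in> C \<Longrightarrow> norm (partial_deriv b g x) \<le> K b" by metis
  define L where "L = (\<Sum>b\<in>Basis. \<bar>K b\<bar>)"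
  have L: "L \<ge> 0" unfolding L_def by (simp add: sum_nonneg)
  have "norm (g x - g y) \<le> L * norm (x - y)" if "x \<in> C" "y \<in> C" for x y
  proof (rule differentiable_bound[OF assms(3) _ _ that])
    fix x assume x: "x \<in> C"
    let ?D = "frechet_derivative g (at x)"
    have D: "(g has_derivative ?D) (at x)"
      using assms x by (auto simp flip: frechet_derivative_works)
    then show "(g has_derivative ?D) (at x within C)" by (rule has_derivative_at_withinI)
    have lin: "linear ?D" using D has_derivative_linear by blast
    show "onorm ?D \<le> L"
    proof (rule onorm_le)
      fix h
      have "?D h = ?D (\<Sum>b\<in>Basis. (h \<bullet> b) *\<^sub>R b)" by (simp add: euclidean_representation)
      also have "\<dots> = (\<Sum>b\<in>Basis. (h \<bullet> b) *\<^sub>R ?D b)"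
        using lin by (simp add: linear_sum linear_scale)
      finally have "norm (?D h) \<le> (\<Sum>b\<in>Basis. norm ((h \<bullet> b) *\<^sub>R ?D b))"
        by (simp only: norm_sum)
      also have "\<dots> \<le> (\<Sum>b\<in>Basis. norm h * \<bar>K b\<bar>)"
      proof (intro sum_mono)
        fix b :: 'a assume b: "b \<in> Basis"
        show "norm ((h \<bullet> b) *\<^sub>R ?D b) \<le> norm h * \<bar>K b\<bar>"
          using K[OF b x] Basis_le_norm[OF b, of h] unfolding partial_deriv_def
          by (auto intro!: mult_mono)
      qed
      also have "\<dots> = L * norm h" by (simp add: L_def sum_distrib_left mult.commute)
      finally show "norm (?D h) \<le> L * norm h" .
    qed
  qed
  then have "L-lipschitz_on C g" using L by (auto intro!: lipschitz_onI simp: dist_norm)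
  then show ?thesis by (rule that)
qed

text \<open>Near \<open>x\<close> the manifold is the image of a bounded piece of
  \<open>span B\<close> under the inverse chart. A closed ball in the chart is compact and convex,
  which makes the inverse chart Lipschitz on it.\<close>

lemma embedded_submanifold_locally_box_covered:
  fixes M :: "'a::euclidean_space set"
  assumes M: "embedded_submanifold r m M" "r \<ge> 1" and x: "x \<in> M"
  obtains W where "open W" "x \<in> W" "box_covered m (M \<inter> W)"
proof -
  obtain U V and f g :: "'a \<Rightarrow> 'a" and B where
    UV: "open U" "open V" "x \<in> U" "B \<subseteq> Basis" "card B = m" "homeomorphism U V f g"
      "Ck_open r U f" "Ck_open r V g" "f ` (M \<inter> U) = V \<inter> span B"
    using M(1) x unfolding embedded_submanifold_def by metis
  have "f x \<in> V" using UV by (auto simp: homeomorphism_def)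
  then obtain e where e: "e > 0" "cball (f x) e \<subseteq> V"
    using UV(2) open_contains_cball by blast
  have "Ck_open 1 V g" using Ck_open_mono[OF UV(2) M(2)] UV(8) by blast
  then obtain L where L: "L-lipschitz_on (cball (f x) e) g"
    using Ck_open_1_imp_lipschitz[of V g "cball (f x) e"] e(2) by auto
  define W where "W = U \<inter> f -` ball (f x) e"
  have "continuous_on U f" using UV by (simp add: homeomorphism_def)
  then have "open W" unfolding W_def using UV(1) by (simp add: continuous_open_preimage)
  moreover have "x \<in> W" using UV e by (simp add: W_def)
  moreover have "M \<inter> W \<subseteq> g ` (ball (f x) e \<inter> span B)"
  proof
    fix z assume z: "z \<in> M \<inter> W"
    then have "f z \<in> ball (f x) e" "f z \<in> span B" "z = g (f z)"
      using UV(9,6) by (auto simp: W_def homeomorphism_def)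
    then show "z \<in> g ` (ball (f x) e \<inter> span B)" by blast
  qed
  moreover have "box_covered m (g ` (ball (f x) e \<inter> span B))"
  proof (rule box_covered_lipschitz_image)
    show "box_covered m (ball (f x) e \<inter> span B)"
      using box_covered_span[OF UV(4), of "ball (f x) e \<inter> span B"] UV(5)
      by (simp add: bounded_Int)
    show "L-lipschitz_on (ball (f x) e \<inter> span B) g"
      by (rule lipschitz_on_subset[OF L]) auto
  qed
  ultimately show ?thesis using that box_covered_subset by metis
qed

lemma compact_box_covered:
  fixes M :: "'a::euclidean_space set"
  assumes M: "embedded_submanifold r m M" "r \<ge> 1" and C: "compact C" "C \<subseteq> M"
  shows "box_covered m C"
proof -
  have "\<forall>x\<in>C. \<exists>W. open W \<and> x \<in> W \<and> box_covered m (M \<inter> W)"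
    using embedded_submanifold_locally_box_covered[OF M] C(2) by (metis subsetD)
  then obtain W where W: "\<And>x. x \<in> C \<Longrightarrow> open (W x) \<and> x \<in> W x \<and> box_covered m (M \<inter> W x)"
    by metis
  obtain T where T: "T \<subseteq> C" "finite T" "C \<subseteq> (\<Union>x\<in>T. W x)"
    using compactE_image[OF C(1), of C W] W by blast
  have "box_covered m (\<Union>x\<in>T. M \<inter> W x)" using T W by (intro box_covered_UN) auto
  then show ?thesis by (rule box_covered_subset) (use T C in auto)
qed

text \<open>No Borel property of \<open>M\<close> is given, but in \<open>S = M \<inter> T\<close>
  the closed set \<open>closure S\<close> can take the place of \<open>M\<close>.\<close>

lemma bounded_domain_in_borel:
  assumes "bounded_domain_in r m M S"
  shows "S \<in> sets borel"
proof -
  obtain T where T: "open T" "S = M \<inter> T"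
    using assms unfolding bounded_domain_in_def openin_open by blast
  have "closure S \<subseteq> M" using assms unfolding bounded_domain_in_def by blast
  then have "S = closure S \<inter> T" using T closure_subset[of S] by blast
  then show ?thesis using T(1) by (metis borel_closed borel_open closed_closure sets.Int)
qed

lemma space_hausdorff_measure [simp]: "space (hausdorff_measure m :: 'a::euclidean_space measure) = UNIV"
  by (simp add: hausdorff_measure_def space_measure_of_conv)

lemma sets_hausdorff_measure [simp]:
  "sets (hausdorff_measure m :: 'a::euclidean_space measure) = sets borel"
  unfolding hausdorff_measure_def
  using sets.sigma_sets_eq[of "borel :: 'a measure"] by (simp add: sets_measure_of_conv)

text \<open>An inequality only: \<^const>\<open>measure_of\<close> yields the zero measure unless its argument is
  countably additive, which is thus not needed.\<close>

lemma emeasure_hausdorff_measure_le: "emeasure (hausdorff_measure m) X \<le> hausdorff_outer m X"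
  unfolding hausdorff_measure_def emeasure_measure_of_conv by auto

lemma finite_measure_bounded_domain:
  fixes S M :: "'a::euclidean_space set"
  assumes S: "bounded_domain_in r m M S" "r \<ge> 1"
  shows "finite_measure (restrict_space (hausdorff_measure m) S)"
proof
  have "compact (closure S)" using S unfolding bounded_domain_in_def by simp
  then have "box_covered m (closure S)"
    using S compact_box_covered unfolding bounded_domain_in_def by blast
  then have "box_covered m S" using box_covered_subset closure_subset by blast
  then have "emeasure (hausdorff_measure m) S < \<infinity>"
    using hausdorff_outer_finite emeasure_hausdorff_measure_le le_less_trans by blast
  moreover have "S \<in> sets (hausdorff_measure m)"
    using bounded_domain_in_borel[OF S(1)] by simp
  ultimately show "emeasure (restrict_space (hausdorff_measure m) S)
      (space (restrict_space (hausdorff_measure m) S)) \<noteq> \<infinity>"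
    by (simp add: space_restrict_space emeasure_restrict_space)
qed

section \<open>Orthogonal projection in \<open>L^2\<close>\<close>

lemma L2_measurable: "f \<in> L2 \<mu> \<Longrightarrow> f \<in> borel_measurable \<mu>"
  and L2_integrable: "f \<in> L2 \<mu> \<Longrightarrow> integrable \<mu> (\<lambda>x. (cmod (f x))\<^sup>2)"
  by (auto simp: L2_def)

lemma cmod_lincomb_square_le: "(cmod (x + c * y))\<^sup>2 \<le> 2 * (cmod x)\<^sup>2 + 2 * (cmod c)\<^sup>2 * (cmod y)\<^sup>2"
proof -
  have "(cmod (x + c * y))\<^sup>2 \<le> (cmod x + cmod c * cmod y)\<^sup>2"
    by (intro power_mono) (auto simp: norm_mult intro: norm_triangle_le)
  also have "\<dots> \<le> 2 * (cmod x)\<^sup>2 + 2 * (cmod c)\<^sup>2 * (cmod y)\<^sup>2"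
    using zero_le_power2[of "cmod x - cmod c * cmod y"]
    by (simp add: power2_eq_square algebra_simps)
  finally show ?thesis .
qed

lemma L2_lincomb:
  assumes "f \<in> L2 \<mu>" "g \<in> L2 \<mu>"
  shows "(\<lambda>x. f x + c * g x) \<in> L2 \<mu>"
proof -
  note [measurable] = assms[THEN L2_measurable]
  have "integrable \<mu> (\<lambda>x. (cmod (f x + c * g x))\<^sup>2)"
  proof (rule Bochner_Integration.integrable_bound)
    show "integrable \<mu> (\<lambda>x. 2 * (cmod (f x))\<^sup>2 + 2 * (cmod c)\<^sup>2 * (cmod (g x))\<^sup>2)"
      using assms[THEN L2_integrable] by auto
  qed (auto simp: cmod_lincomb_square_le)
  then show ?thesis unfolding L2_def by auto
qed

lemma L2_cong: "(\<And>x. x \<in> space \<mu> \<Longrightarrow> f x = g x) \<Longrightarrow> f \<in> L2 \<mu> \<longleftrightarrow> g \<in> L2 \<mu>"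
  unfolding L2_def by (auto cong: measurable_cong Bochner_Integration.integrable_cong)

lemma L2_norm_cong: "(\<And>x. x \<in> space \<mu> \<Longrightarrow> f x = g x) \<Longrightarrow> L2_norm \<mu> f = L2_norm \<mu> g"
  unfolding L2_norm_def by (simp cong: Bochner_Integration.integral_cong)

lemma L2_norm_nonneg [simp]: "L2_norm \<mu> f \<ge> 0"
  unfolding L2_norm_def by simp

lemma L2_norm_square: "(L2_norm \<mu> f)\<^sup>2 = (LINT x|\<mu>. (cmod (f x))\<^sup>2)"
  unfolding L2_norm_def by simp

lemma L2_norm_scale: "L2_norm \<mu> (\<lambda>x. c * f x) = cmod c * L2_norm \<mu> f"
  unfolding L2_norm_def by (simp add: norm_mult power_mult_distrib real_sqrt_mult)

lemma integrable_L2_inner: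
  assumes "f \<in> L2 \<mu>" "g \<in> L2 \<mu>"
  shows "integrable \<mu> (\<lambda>x. f x * cnj (g x))"
proof (rule Bochner_Integration.integrable_bound)
  note [measurable] = assms[THEN L2_measurable]
  show "integrable \<mu> (\<lambda>x. (cmod (f x))\<^sup>2 + (cmod (g x))\<^sup>2)"
    using assms[THEN L2_integrable] by auto
  have "cmod (f x) * cmod (g x) \<le> (cmod (f x))\<^sup>2 + (cmod (g x))\<^sup>2" for x
    using sum_squares_bound[of "cmod (f x)" "cmod (g x)"]
      mult_nonneg_nonneg[OF norm_ge_zero norm_ge_zero, of "f x" "g x"] by linarith
  then show "AE x in \<mu>. norm (f x * cnj (g x)) \<le> norm ((cmod (f x))\<^sup>2 + (cmod (g x))\<^sup>2)"
    by (simp add: norm_mult)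
  have "(\<lambda>x. cnj (g x)) \<in> borel_measurable \<mu>"
    by (intro borel_measurable_continuous_on[OF continuous_on_cnj[OF continuous_on_id]]) simp
  then show "(\<lambda>x. f x * cnj (g x)) \<in> borel_measurable \<mu>" by simp
qed

lemma cmod_add_square: "(cmod (x + c * y))\<^sup>2 =
    (cmod x)\<^sup>2 + 2 * Re (cnj c * (x * cnj y)) + (cmod c)\<^sup>2 * (cmod y)\<^sup>2"
  unfolding cmod_power2 by (simp add: power2_eq_square algebra_simps)

text \<open>Common source of the Cauchy-Schwarz and triangle inequalities, of the parallelogram law
  (\<open>c = 1\<close> and \<open>c = -1\<close>) and of the variation that yields
  orthogonality.\<close>

lemma L2_norm_lincomb_square:
  assumes "f \<in> L2 \<mu>" "g \<in> L2 \<mu>"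
  shows "(L2_norm \<mu> (\<lambda>x. f x + c * g x))\<^sup>2 =
    (L2_norm \<mu> f)\<^sup>2 + 2 * Re (cnj c * L2_inner \<mu> f g) + (cmod c)\<^sup>2 * (L2_norm \<mu> g)\<^sup>2"
proof -
  have "integrable \<mu> (\<lambda>x. cnj c * (f x * cnj (g x)))"
    using integrable_L2_inner[OF assms] by simp
  moreover from this have "(LINT x|\<mu>. Re (cnj c * (f x * cnj (g x)))) = Re (cnj c * L2_inner \<mu> f g)"
    using integrable_L2_inner[OF assms]
    by (subst integral_Re) (simp_all add: L2_inner_def del: times_complex.sel)
  ultimately show ?thesis
    unfolding L2_norm_square cmod_add_square
    using assms[THEN L2_integrable] by (simp add: integrable_Re del: times_complex.sel)
qed

lemma L2_Cauchy_Schwarz: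
  assumes "f \<in> L2 \<mu>" "g \<in> L2 \<mu>"
  shows "Re (L2_inner \<mu> f g) \<le> L2_norm \<mu> f * L2_norm \<mu> g"
proof -
  define a b r where "a = L2_norm \<mu> f" and "b = L2_norm \<mu> g" and "r = Re (L2_inner \<mu> f g)"
  have quad: "0 \<le> a\<^sup>2 - 2 * t * r + t\<^sup>2 * b\<^sup>2" for t :: real
  proof -
    have "(L2_norm \<mu> (\<lambda>x. f x + complex_of_real (- t) * g x))\<^sup>2 = a\<^sup>2 - 2 * t * r + t\<^sup>2 * b\<^sup>2"
      using L2_norm_lincomb_square[OF assms, of "complex_of_real (- t)"]
      by (simp add: a_def b_def r_def)
    then show ?thesis by (metis zero_le_power2)
  qed
  have ab: "a \<ge> 0" "b \<ge> 0" by (simp_all add: a_def b_def)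
  show ?thesis
  proof (rule ccontr)
    assume "\<not> ?thesis"
    then have r: "r > a * b" by (simp add: a_def b_def r_def)
    then have r0: "r > 0" using ab by (meson le_less_trans mult_nonneg_nonneg)
    show False
    proof (cases "b = 0")
      case True
      \<comment> \<open>The polynomial is affine in this case, and this argument gives it the value
        -1.\<close>
      then show False using quad[of "(a\<^sup>2 + 1) / (2 * r)"] r0 by (simp add: field_simps)
    next
      case False
      \<comment> \<open>The minimiser of the quadratic polynomial is inserted.\<close>
      then have "0 \<le> a\<^sup>2 - r\<^sup>2 / b\<^sup>2" using quad[of "r / b\<^sup>2"] by (simp add: field_simps power2_eq_square)
      then have "r\<^sup>2 \<le> (a * b)\<^sup>2" using False by (simp add: field_simps power_mult_distrib)
      then have "r \<le> a * b" by (rule power2_le_imp_le[OF _ mult_nonneg_nonneg[OF ab]])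
      then show False using r by simp
    qed
  qed
qed

lemma L2_norm_triangle:
  assumes "f \<in> L2 \<mu>" "g \<in> L2 \<mu>"
  shows "L2_norm \<mu> (\<lambda>x. f x + g x) \<le> L2_norm \<mu> f + L2_norm \<mu> g"
proof (rule power2_le_imp_le)
  show "(L2_norm \<mu> (\<lambda>x. f x + g x))\<^sup>2 \<le> (L2_norm \<mu> f + L2_norm \<mu> g)\<^sup>2"
    using L2_norm_lincomb_square[OF assms, of 1] L2_Cauchy_Schwarz[OF assms]
    by (simp add: power2_sum)
qed simp

lemma (in finite_measure) L2_bounded:
  assumes [measurable]: "f \<in> borel_measurable M" and "\<And>x. x \<in> space M \<Longrightarrow> cmod (f x) \<le> K"
  shows "f \<in> L2 M"
proof -
  have "integrable M (\<lambda>x. (cmod (f x))\<^sup>2)"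
    by (rule integrable_const_bound[of _ "K\<^sup>2"]) (auto intro!: AE_I2 power_mono assms(2))
  then show ?thesis unfolding L2_def by simp
qed

text \<open>Finiteness of the measure gives summability almost everywhere directly from the estimate
  \<open>\<bar>d\<bar> \<le> (t + \<bar>d\<bar>^2 / t) / 2\<close> with \<open>t = 2^{-n}\<close>.\<close>

lemma (in finite_measure) L2_complete:
  assumes w: "\<And>n. w n \<in> L2 M"
    and Cauchy: "\<And>n m. n \<le> m \<Longrightarrow> (L2_norm M (\<lambda>x. w m x - w n x))\<^sup>2 \<le> (1/4) ^ n"
  obtains f where "f \<in> L2 M" "(\<lambda>n. L2_norm M (\<lambda>x. w n x - f x)) \<longlonglongrightarrow> 0"
proof -
  note [measurable] = w[THEN L2_measurable]
  define d where "d = (\<lambda>n x. w (Suc n) x - w n x)"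
  have diff_L2: "(\<lambda>x. w m x - w n x) \<in> L2 M" for m n
    using L2_lincomb[OF w w, of m "-1" n] by simp
  have dL2: "d n \<in> L2 M" for n unfolding d_def by (rule diff_L2)
  have [measurable]: "d n \<in> borel_measurable M" for n using dL2 by (rule L2_measurable)
  have bound: "cmod z \<le> (1/2) ^ n / 2 + 2 ^ n / 2 * (cmod z)\<^sup>2" for z n
  proof -
    \<comment> \<open>The reciprocal of the parameter in the explanation above the lemma.\<close>
    define t :: real where "t = 2 ^ n"
    have t: "t > 0" by (simp add: t_def)
    have "0 \<le> (1 - t * cmod z)\<^sup>2 / t" using t by simp
    also have "\<dots> = 1 / t + t * (cmod z)\<^sup>2 - 2 * cmod z"
      using t by (simp add: power2_eq_square field_simps)
    finally show ?thesis using t by (simp add: t_def power_divide)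
  qed
  have int_bd: "integrable M (\<lambda>x. (1/2) ^ n / 2 + 2 ^ n / 2 * (cmod (d n x))\<^sup>2)" for n
    using dL2[of n, THEN L2_integrable] by auto
  have int: "integrable M (\<lambda>x. cmod (d n x))" for n
    by (rule Bochner_Integration.integrable_bound[OF int_bd[of n]])
      (auto intro!: AE_I2 order_trans[OF bound])
  have int_le: "(LINT x|M. cmod (d n x)) \<le> (measure M (space M) + 1) / 2 * (1/2) ^ n" for n
  proof -
    have "(LINT x|M. cmod (d n x)) \<le> (LINT x|M. (1/2) ^ n / 2 + 2 ^ n / 2 * (cmod (d n x))\<^sup>2)"
      by (intro integral_mono int int_bd bound)
    also have "\<dots> = measure M (space M) * ((1/2) ^ n / 2) + 2 ^ n / 2 * (L2_norm M (d n))\<^sup>2"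
      using dL2[of n, THEN L2_integrable] by (simp add: L2_norm_square)
    also have "\<dots> \<le> measure M (space M) * ((1/2) ^ n / 2) + 2 ^ n / 2 * (1/4) ^ n"
      using Cauchy[of n "Suc n"] unfolding d_def by (intro add_left_mono mult_left_mono) auto
    also have "(2::real) ^ n / 2 * (1/4) ^ n = (1/2) ^ n / 2"
      by (simp flip: power_mult_distrib)
    finally show ?thesis by (simp add: algebra_simps add_divide_distrib)
  qed
  have "AE x in M. summable (\<lambda>n. cmod (d n x))"
  proof -
    have "(\<integral>\<^sup>+x. (\<Sum>n. ennreal (cmod (d n x))) \<partial>M) = (\<Sum>n. \<integral>\<^sup>+x. ennreal (cmod (d n x)) \<partial>M)"
      by (rule nn_integral_suminf) simp
    also have "\<dots> = (\<Sum>n. ennreal (LINT x|M. cmod (d n x)))"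
      using int by (subst nn_integral_eq_integral) auto
    also have "\<dots> \<le> (\<Sum>n. ennreal ((measure M (space M) + 1) / 2 * (1/2) ^ n))"
      by (intro suminf_le ennreal_leI int_le) auto
    also have "\<dots> = ennreal (\<Sum>n. (measure M (space M) + 1) / 2 * (1/2) ^ n)"
      by (intro suminf_ennreal2) (auto intro: summable_mult)
    also have "\<dots> < \<infinity>" by simp
    finally have "AE x in M. (\<Sum>n. ennreal (cmod (d n x))) \<noteq> \<infinity>"
      by (intro nn_integral_PInf_AE) auto
    then show ?thesis
      by eventually_elim (auto intro!: summable_suminf_not_top)
  qed
  then have conv: "AE x in M. convergent (\<lambda>n. w n x)"
  proof eventually_elim
    case (elim x)
    then have "summable (\<lambda>n. d n x)" by (rule summable_norm_cancel)
    then have "convergent (\<lambda>n. \<Sum>i<n. d i x)" by (simp add: summable_iff_convergent)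
    moreover have "(\<Sum>i<n. d i x) = w n x - w 0 x" for n
      unfolding d_def by (rule sum_lessThan_telescope)
    ultimately have "convergent (\<lambda>n. (w n x - w 0 x) + w 0 x)"
      by (intro convergent_add convergent_const) auto
    then show ?case by simp
  qed
  \<comment> \<open>Measurable everywhere, but known to be the limit only almost everywhere.\<close>
  define f where "f = (\<lambda>x. lim (\<lambda>n. w n x))"
  have [measurable]: "f \<in> borel_measurable M" unfolding f_def by (intro borel_measurable_lim_metric) simp
  have lim: "AE x in M. (\<lambda>n. w n x) \<longlonglongrightarrow> f x"
    using conv by eventually_elim (simp add: f_def convergent_LIMSEQ_iff)
  \<comment> \<open>Fatou's lemma in \<open>m\<close> for fixed \<open>n\<close> transfers the
    Cauchy bound to the limit, without a dominating function.\<close>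
  have Fatou: "(\<integral>\<^sup>+x. ennreal ((cmod (w n x - f x))\<^sup>2) \<partial>M) \<le> ennreal ((1/4) ^ n)" for n
  proof -
    have "(\<integral>\<^sup>+x. ennreal ((cmod (w n x - f x))\<^sup>2) \<partial>M)
        = (\<integral>\<^sup>+x. liminf (\<lambda>m. ennreal ((cmod (w m x - w n x))\<^sup>2)) \<partial>M)"
    proof (intro nn_integral_cong_AE)
      show "AE x in M. ennreal ((cmod (w n x - f x))\<^sup>2) = liminf (\<lambda>m. ennreal ((cmod (w m x - w n x))\<^sup>2))"
        using lim
      proof eventually_elim
        case (elim x)
        then have "(\<lambda>m. ennreal ((cmod (w m x - w n x))\<^sup>2)) \<longlonglongrightarrow> ennreal ((cmod (f x - w n x))\<^sup>2)"
          by (intro tendsto_ennrealI tendsto_power tendsto_norm tendsto_diff tendsto_const)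
        from lim_imp_Liminf[OF sequentially_bot this] show ?case
          by (simp add: norm_minus_commute)
      qed
    qed
    also have "\<dots> \<le> liminf (\<lambda>m. \<integral>\<^sup>+x. ennreal ((cmod (w m x - w n x))\<^sup>2) \<partial>M)"
      by (rule nn_integral_liminf) simp
    also have "\<dots> = liminf (\<lambda>m. ennreal ((L2_norm M (\<lambda>x. w m x - w n x))\<^sup>2))"
      unfolding L2_norm_square
      using diff_L2[THEN L2_integrable] by (subst nn_integral_eq_integral) auto
    also have "\<dots> \<le> liminf (\<lambda>m::nat. ennreal ((1/4) ^ n))"
      by (intro Liminf_mono eventually_sequentiallyI[of n] ennreal_leI Cauchy)
    also have "\<dots> = ennreal ((1/4) ^ n)" by (simp add: Liminf_const)
    finally show ?thesis .
  qed
  have wf: "(\<lambda>x. w n x - f x) \<in> L2 M" for n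
  proof -
    have "integrable M (\<lambda>x. (cmod (w n x - f x))\<^sup>2)"
      using le_less_trans[OF Fatou[of n]] by (intro integrableI_bounded) auto
    then show ?thesis by (simp add: L2_def)
  qed
  have norm_le: "L2_norm M (\<lambda>x. w n x - f x) \<le> (1/2) ^ n" for n
  proof (rule power2_le_imp_le)
    have "ennreal ((L2_norm M (\<lambda>x. w n x - f x))\<^sup>2) \<le> ennreal ((1/4) ^ n)"
      using Fatou[of n] wf[of n, THEN L2_integrable]
      unfolding L2_norm_square by (subst (asm) nn_integral_eq_integral) auto
    also have "((1/4) ^ n :: real) = ((1/2) ^ n)\<^sup>2"
      by (simp add: power2_eq_square flip: power_mult_distrib)
    finally show "(L2_norm M (\<lambda>x. w n x - f x))\<^sup>2 \<le> ((1/2) ^ n)\<^sup>2" by (subst (asm) ennreal_le_iff) auto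
  qed simp
  have "f \<in> L2 M" using L2_lincomb[OF w[of 0] wf[of 0], of "-1"] by simp
  moreover have "(\<lambda>n. L2_norm M (\<lambda>x. w n x - f x)) \<longlonglongrightarrow> 0"
    by (rule tendsto_sandwich[of "\<lambda>_. 0" _ _ "\<lambda>n. (1/2) ^ n"])
      (auto simp: norm_le intro!: LIMSEQ_realpow_zero)
  ultimately show ?thesis by (rule that)
qed

text \<open>The parallelogram law makes a minimising sequence for the distance from \<open>u\<close>
  to \<open>E\<close> Cauchy, and a minimiser admits no first-order decrease in any direction of
  \<open>E\<close>.\<close>

lemma (in finite_measure) L2_projection:
  assumes closed: "L2_closed M E" and "E \<noteq> {}"
    and lincomb: "\<And>f g c. f \<in> E \<Longrightarrow> g \<in> E \<Longrightarrow> (\<lambda>x. f x + c * g x) \<in> E"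
    and u: "u \<in> L2 M"
  obtains v where "v \<in> E" "(\<lambda>x. u x - v x) \<in> L2_perp M E"
proof -
  have EL2: "E \<subseteq> L2 M" using closed by (simp add: L2_closed_def)
  define D where "D = (\<lambda>w. (L2_norm M (\<lambda>x. u x - w x))\<^sup>2)"
  define \<delta> where "\<delta> = (INF w\<in>E. D w)"
  have bdd: "bdd_below (D ` E)" by (intro bdd_belowI2[of _ 0]) (simp add: D_def)
  have \<delta>: "\<delta> \<le> D w" if "w \<in> E" for w
    unfolding \<delta>_def using bdd that by (rule cINF_lower)
  \<comment> \<open>The slack is chosen for \<open>L2_complete\<close>: in the parallelogram law the
    terms with \<open>\<delta>\<close> cancel, and twice the slack of \<open>n\<close> plus twice
    that of \<open>m\<close> is at most \<open>(1/4) ^ n\<close>.\<close>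
  have "\<exists>w\<in>E. D w < \<delta> + (1/4) ^ n / 4" for n
    using cINF_less_iff[OF \<open>E \<noteq> {}\<close> bdd, of "\<delta> + (1/4) ^ n / 4"] by (simp add: \<delta>_def)
  then obtain w where w: "\<And>n. w n \<in> E" "\<And>n. D (w n) < \<delta> + (1/4) ^ n / 4" by metis
  have wL2: "w n \<in> L2 M" for n using w(1) EL2 by blast
  have diff: "(\<lambda>x. f x - g x) \<in> L2 M" if "f \<in> L2 M" "g \<in> L2 M" for f g
    using L2_lincomb[OF that, of "-1"] by simp
  have Cauchy: "(L2_norm M (\<lambda>x. w m x - w n x))\<^sup>2 \<le> (1/4) ^ n" if "n \<le> m" for n m
  proof -
    let ?p = "\<lambda>x. u x - w n x" and ?r = "\<lambda>x. u x - w m x"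
    let ?a = "\<lambda>x. (1/2) * w n x + (1/2) * w m x"
    have pr: "?p \<in> L2 M" "?r \<in> L2 M" using diff u wL2 by auto
    \<comment> \<open>The midpoint is assembled from the one closure rule available,
      \<open>f + c * g\<close>.\<close>
    have "(\<lambda>x. w n x + (-1/2) * w n x) \<in> E" using lincomb[OF w(1) w(1), of n "-1/2" n] by simp
    then have "(\<lambda>x. (w n x + (-1/2) * w n x) + (1/2) * w m x) \<in> E" by (rule lincomb[OF _ w(1)])
    then have "?a \<in> E" by (simp add: algebra_simps)
    then have mid: "\<delta> \<le> D ?a" by (rule \<delta>)
    have "L2_norm M (\<lambda>x. ?p x + 1 * ?r x) = 2 * L2_norm M (\<lambda>x. u x - ?a x)"
      using L2_norm_scale[of M 2 "\<lambda>x. u x - ?a x"] by (simp add: algebra_simps)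
    then have "(L2_norm M (\<lambda>x. ?p x + 1 * ?r x))\<^sup>2 = 4 * D ?a" by (simp add: D_def power_mult_distrib)
    moreover have "(L2_norm M (\<lambda>x. ?p x + 1 * ?r x))\<^sup>2 + (L2_norm M (\<lambda>x. ?p x + (-1) * ?r x))\<^sup>2
        = 2 * D (w n) + 2 * D (w m)"
      using L2_norm_lincomb_square[OF pr, of 1] L2_norm_lincomb_square[OF pr, of "-1"]
      by (simp add: D_def)
    moreover have "(\<lambda>x. ?p x + (-1) * ?r x) = (\<lambda>x. w m x - w n x)" by (simp add: fun_eq_iff)
    moreover have "((1/4) ^ m :: real) \<le> (1/4) ^ n" using that by (intro power_decreasing) auto
    ultimately show ?thesis using mid w(2)[of n] w(2)[of m] by (simp only:)
  qed
  obtain f where f: "f \<in> L2 M" "(\<lambda>n. L2_norm M (\<lambda>x. w n x - f x)) \<longlonglongrightarrow> 0"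
    using L2_complete[OF wL2 Cauchy] by blast
  \<comment> \<open>The limit is exchanged for a member of \<open>E\<close> that agrees with it
    almost everywhere; distances are unaffected.\<close>
  then obtain v where v: "v \<in> E" "AE x in M. v x = f x"
    using closed w(1) unfolding L2_closed_def by meson
  have vL2: "v \<in> L2 M" using v EL2 by blast
  define z where "z = (\<lambda>x. u x - v x)"
  have zL2: "z \<in> L2 M" unfolding z_def by (rule diff[OF u vL2])
  have "L2_norm M z \<le> sqrt \<delta>"
  proof (rule LIMSEQ_le_const)
    have "(\<lambda>n. \<delta> + (1/4) ^ n / 4) \<longlonglongrightarrow> \<delta> + 0 / 4"
      by (intro tendsto_intros LIMSEQ_realpow_zero) auto
    then have "(\<lambda>n. sqrt (\<delta> + (1/4) ^ n / 4)) \<longlonglongrightarrow> sqrt \<delta>"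
      by (intro tendsto_real_sqrt) simp
    from tendsto_add[OF this f(2)]
    show "(\<lambda>n. sqrt (\<delta> + (1/4) ^ n / 4) + L2_norm M (\<lambda>x. w n x - f x)) \<longlonglongrightarrow> sqrt \<delta>" by simp
    have "L2_norm M z \<le> sqrt (\<delta> + (1/4) ^ n / 4) + L2_norm M (\<lambda>x. w n x - f x)" for n
    proof -
      have "L2_norm M z = L2_norm M (\<lambda>x. (u x - w n x) + (w n x - v x))" by (simp add: z_def)
      also have "\<dots> \<le> L2_norm M (\<lambda>x. u x - w n x) + L2_norm M (\<lambda>x. w n x - v x)"
        by (intro L2_norm_triangle diff u wL2 vL2)
      also have "L2_norm M (\<lambda>x. w n x - v x) = L2_norm M (\<lambda>x. w n x - f x)"
        unfolding L2_norm_def using v(2) L2_measurable[OF wL2] L2_measurable[OF vL2] L2_measurable[OF f(1)]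
        by (auto intro!: arg_cong[of _ _ sqrt] integral_cong_AE)
      also have "L2_norm M (\<lambda>x. u x - w n x) \<le> sqrt (\<delta> + (1/4) ^ n / 4)"
        using w(2)[of n] by (intro real_le_rsqrt) (simp add: D_def)
      finally show ?thesis by simp
    qed
    then show "\<exists>N. \<forall>n\<ge>N. L2_norm M z \<le> sqrt (\<delta> + (1/4) ^ n / 4) + L2_norm M (\<lambda>x. w n x - f x)" by blast
  qed
  moreover have "\<delta> \<ge> 0" unfolding \<delta>_def using \<open>E \<noteq> {}\<close> by (intro cINF_greatest) (auto simp: D_def)
  ultimately have z_le: "(L2_norm M z)\<^sup>2 \<le> \<delta>" using power_mono[of "L2_norm M z" "sqrt \<delta>" 2] by simp
  have "L2_inner M z e = 0" if e: "e \<in> E" for e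
  proof (rule ccontr)
    assume ne: "L2_inner M z e \<noteq> 0"
    have eL2: "e \<in> L2 M" using e EL2 by blast
    define i r where "i = L2_inner M z e" and "r = (L2_norm M e)\<^sup>2"
    \<comment> \<open>Moving from \<open>v\<close> by \<open>t * i * e\<close> changes the squared
      distance by \<open>t * (cmod i)\<^sup>2 * (t * r - 2)\<close>, which is negative for this
      \<open>t\<close> and contradicts minimality.\<close>
    define t where "t = 1 / (r + 1)"
    have r: "r \<ge> 0" by (simp add: r_def)
    have t: "t > 0" "t * r < 1" using r by (auto simp: t_def field_simps)
    define c where "c = - complex_of_real t * i"
    have "(\<lambda>x. v x + (- c) * e x) \<in> E" by (rule lincomb[OF v(1) e])
    then have "\<delta> \<le> D (\<lambda>x. v x + (- c) * e x)" by (rule \<delta>)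
    also have "\<dots> = (L2_norm M (\<lambda>x. z x + c * e x))\<^sup>2" by (simp add: D_def z_def algebra_simps)
    also have "\<dots> = (L2_norm M z)\<^sup>2 + 2 * Re (cnj c * i) + (cmod c)\<^sup>2 * r"
      using L2_norm_lincomb_square[OF zL2 eL2] by (simp add: i_def r_def)
    also have "cnj c * i = complex_of_real (- t * (cmod i)\<^sup>2)"
      using complex_norm_square[of i] by (simp add: c_def mult.commute)
    also have "(cmod c)\<^sup>2 = t\<^sup>2 * (cmod i)\<^sup>2" by (simp add: c_def norm_mult power_mult_distrib)
    finally have "0 \<le> 2 * Re (complex_of_real (- t * (cmod i)\<^sup>2)) + t\<^sup>2 * (cmod i)\<^sup>2 * r"
      using z_le by linarith
    then have "0 \<le> (t * (cmod i)\<^sup>2) * (t * r - 2)" by (simp add: algebra_simps power2_eq_square)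
    moreover have "t * (cmod i)\<^sup>2 > 0" using t ne by (simp add: i_def)
    ultimately have "t * r - 2 \<ge> 0" by (simp add: zero_le_mult_iff)
    then show False using t by simp
  qed
  then have "z \<in> L2_perp M E" using zL2 by (simp add: L2_perp_def)
  then show ?thesis using that[OF v(1)] by (simp add: z_def)
qed

text \<open>By \<open>2 * a * b \<le> a\<^sup>2 + b\<^sup>2\<close> the mixed term consumes at most
  the fraction \<open>\<theta>\<close> of \<open>a\<^sup>2 + b\<^sup>2\<close>.\<close>

lemma L2_norm_strengthened_Cauchy_Schwarz:
  assumes fg: "f \<in> L2 \<mu>" "g \<in> L2 \<mu>"
    and angle: "cmod (L2_inner \<mu> f g) \<le> \<theta> * L2_norm \<mu> f * L2_norm \<mu> g" and \<theta>: "0 \<le> \<theta>" "\<theta> < 1"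
  shows "sqrt (1 - \<theta>) * L2_norm \<mu> f \<le> L2_norm \<mu> (\<lambda>x. f x + c * g x)"
    and "sqrt (1 - \<theta>) * (cmod c * L2_norm \<mu> g) \<le> L2_norm \<mu> (\<lambda>x. f x + c * g x)"
proof -
  define a b where "a = L2_norm \<mu> f" and "b = cmod c * L2_norm \<mu> g"
  have ab: "a \<ge> 0" "b \<ge> 0" by (simp_all add: a_def b_def)
  define R where "R = Re (cnj c * L2_inner \<mu> f g)"
  have "- R \<le> cmod (cnj c * L2_inner \<mu> f g)"
    unfolding R_def using abs_Re_le_cmod[of "cnj c * L2_inner \<mu> f g"] by linarith
  also have "\<dots> \<le> cmod c * (\<theta> * L2_norm \<mu> f * L2_norm \<mu> g)"
    unfolding norm_mult complex_mod_cnj by (intro mult_left_mono angle) simp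
  also have "\<dots> = \<theta> * (a * b)" by (simp add: a_def b_def)
  finally have "- R \<le> \<theta> * (a * b)" .
  moreover have "2 * (\<theta> * (a * b)) \<le> \<theta> * (a\<^sup>2 + b\<^sup>2)"
    using mult_left_mono[OF sum_squares_bound[of a b] \<theta>(1)] by (simp add: mult_ac)
  ultimately have "(a\<^sup>2 + b\<^sup>2) - \<theta> * (a\<^sup>2 + b\<^sup>2) \<le> a\<^sup>2 + 2 * R + b\<^sup>2"
    unfolding distrib_left by linarith
  then have "(1 - \<theta>) * (a\<^sup>2 + b\<^sup>2) \<le> a\<^sup>2 + 2 * R + b\<^sup>2" by (simp add: algebra_simps)
  also have "\<dots> = (L2_norm \<mu> (\<lambda>x. f x + c * g x))\<^sup>2"
    unfolding L2_norm_lincomb_square[OF fg] by (simp add: a_def b_def R_def power_mult_distrib)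
  finally have "(1 - \<theta>) * (a\<^sup>2 + b\<^sup>2) \<le> (L2_norm \<mu> (\<lambda>x. f x + c * g x))\<^sup>2" .
  note le = order_trans[OF _ this]
  have "(1 - \<theta>) * a\<^sup>2 \<le> (1 - \<theta>) * (a\<^sup>2 + b\<^sup>2)" "(1 - \<theta>) * b\<^sup>2 \<le> (1 - \<theta>) * (a\<^sup>2 + b\<^sup>2)"
    using \<theta>(2) by (auto intro!: mult_left_mono)
  from this[THEN le] have "(sqrt (1 - \<theta>) * a)\<^sup>2 \<le> (L2_norm \<mu> (\<lambda>x. f x + c * g x))\<^sup>2"
    "(sqrt (1 - \<theta>) * b)\<^sup>2 \<le> (L2_norm \<mu> (\<lambda>x. f x + c * g x))\<^sup>2"
    using \<theta>(2) by (simp_all add: power_mult_distrib)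
  then show "sqrt (1 - \<theta>) * L2_norm \<mu> f \<le> L2_norm \<mu> (\<lambda>x. f x + c * g x)"
    "sqrt (1 - \<theta>) * (cmod c * L2_norm \<mu> g) \<le> L2_norm \<mu> (\<lambda>x. f x + c * g x)"
    unfolding a_def b_def by (auto intro: power2_le_imp_le)
qed

text \<open>Conjugate symmetry makes \<open>ip f f\<close> real, so definiteness passes to its real
  part. Positivity is needed because the lower bound for the discrete solution divides by this
  norm.\<close>

lemma hnorm_pos:
  assumes H: "hilbert_function_space \<Omega> H ip" and f: "f \<in> H" "f z \<noteq> 0"
  shows "hnorm ip f > 0"
proof -
  have "ip f f \<noteq> 0" "Re (ip f f) \<ge> 0"
    using H f unfolding hilbert_function_space_def by blast+
  moreover have "ip f f = cnj (ip f f)"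
    using H f unfolding hilbert_function_space_def by blast
  then have "Im (ip f f) = 0" by (metis Im_complex_of_real Reals_cases Reals_cnj_iff)
  ultimately have "Re (ip f f) > 0" by (simp add: complex_eq_iff)
  then show ?thesis by (simp add: hnorm_def)
qed

lemma L2_norm_pos_imp_nonzero:
  assumes "L2_norm \<mu> f > 0"
  obtains x where "x \<in> space \<mu>" "f x \<noteq> 0"
proof -
  have "\<exists>x\<in>space \<mu>. f x \<noteq> 0"
  proof (rule ccontr)
    assume "\<not> ?thesis"
    then have "L2_norm \<mu> f = L2_norm \<mu> (\<lambda>x. 0)" by (intro L2_norm_cong) auto
    then show False using assms by (simp add: L2_norm_def)
  qed
  then show ?thesis using that by blast
qed

section \<open>The a posteriori estimate\<close>

text \<open>Compactness of the closure bounds \<open>u\<close>, and the measure of \<open>S\<close>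
  is finite.\<close>

lemma continuous_on_closure_in_L2:
  assumes S: "bounded_domain_in r m M S" "r \<ge> 1" and u: "continuous_on (closure S) u"
  shows "u \<in> L2 (restrict_space (hausdorff_measure m) S)"
proof -
  interpret finite_measure "restrict_space (hausdorff_measure m) S"
    by (rule finite_measure_bounded_domain[OF S])
  have space: "space (restrict_space (hausdorff_measure m) S) = S"
    by (simp add: space_restrict_space)
  have "compact (closure S)" using S unfolding bounded_domain_in_def by simp
  then have "bounded (u ` closure S)"
    using u compact_continuous_image compact_imp_bounded by blast
  then obtain K where K: "\<And>x. x \<in> closure S \<Longrightarrow> cmod (u x) \<le> K"
    unfolding bounded_iff by auto
  have "u \<in> borel_measurable (restrict_space borel S)"
    by (rule borel_measurable_continuous_on_restrict[OF continuous_on_subset[OF u closure_subset]])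
  moreover have sets: "sets (restrict_space (hausdorff_measure m) S) = sets (restrict_space borel S)"
    by (intro sets_restrict_space_cong sets_hausdorff_measure)
  ultimately have "u \<in> borel_measurable (restrict_space (hausdorff_measure m) S)"
    by (simp only: measurable_cong_sets[OF sets refl])
  then show ?thesis
    by (rule L2_bounded) (use K closure_subset space in auto)
qed

text \<open>Quantifying the four constants before the point sequences, \<open>l\<close> and
  \<open>u\<close> expresses their independence. An eigenvalue in \<open>E\<close> has an
  eigenfunction that is \<open>C^q\<close> in \<open>S\<close> but only \<open>C^q'\<close> up to
  the boundary, so \<open>Nk\<close> need not contain it; this explains the conditional clause on
  non-zero members of \<open>Nk\<close>. The order \<open>max 1 q\<close> keeps the charts of
  \<open>M\<close> differentiable for \<open>q = 0\<close>.\<close>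

theorem proposition3:
  fixes S M \<Omega> :: "'a::euclidean_space set"
    and m k q q' Na :: nat
    and \<A> :: "'a bchart set"
    and F G :: "('a \<Rightarrow> complex) \<Rightarrow> 'a \<Rightarrow> complex"
    and a :: "nat \<Rightarrow> 'a" and b :: "nat \<Rightarrow> complex"
    and H :: "('a \<Rightarrow> complex) set"
    and ip :: "('a \<Rightarrow> complex) \<Rightarrow> ('a \<Rightarrow> complex) \<Rightarrow> complex"
    and \<mu> :: "'a measure"
    and E :: "complex set" and Nk :: "('a \<Rightarrow> complex) set"
    and lk \<alpha> :: complex
    and s Ck Bk \<theta> A A' p Qa bmax :: real
  assumes domain: "bounded_domain_in (max 1 q) m M S"
    and boundary: "boundary_atlas k m M S \<A>" "\<bar>s\<bar> \<le> real k + 1"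
    and \<Omega>: "open \<Omega>" "connected \<Omega>" "closure S \<subseteq> \<Omega>"
    and F: "differential_operator q (closure S) S F"
           "\<And>u. Ck_on q (closure S) u \<Longrightarrow> continuous_on S (F u)"
    and G: "differential_operator q' (closure S) (bd S) G" "q' \<le> q"
    and points: "\<And>j. j \<in> {1..Na} \<Longrightarrow> a j \<in> closure S" "\<exists>j\<in>{1..Na}. b j \<noteq> 0"
    and H: "hilbert_function_space \<Omega> H ip" "\<And>f. f \<in> H \<Longrightarrow> Ck_on q (closure S) f"
    and \<mu>: "\<mu> = restrict_space (hausdorff_measure m) S"
    and bmax: "bmax = Max ((\<lambda>j. cmod (b j)) ` {1..Na})"
    and E: "E = eigenvalues q q' S F G Na a b"
    and lk: "lk \<in> E"
    and Nk: "Nk = eigenspace q S F G lk"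
    and assm1: "Ck > 0"
      "\<And>w. Ck_on q' (closure S) w \<Longrightarrow>
         \<exists>g. Ck_on q (closure S) g \<and> (\<forall>x\<in>S. F g x - \<alpha> * g x = 0) \<and>
             (\<forall>x\<in>bd S. G g x = G w x) \<and>
             (G w \<in> boundary_Hs m S \<A> s \<longrightarrow>
                L2_norm \<mu> g \<le> Ck * boundary_Hs_norm m S \<A> s (G w))"
    and assm2: "countable E"
    and assm3: "L2_closed \<mu> Nk"
    and assm4: "Bk > 0"
      "\<And>l u. admissible E lk l \<Longrightarrow> u \<in> L2_perp \<mu> Nk \<inter> CqG q S G \<Longrightarrow>
         (\<lambda>x. F u x - l * u x) \<in> L2 \<mu> \<Longrightarrow>
         Bk * L2_norm \<mu> u \<le> L2_norm \<mu> (\<lambda>x. F u x - l * u x)"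
    and assm5: "0 \<le> \<theta>" "\<theta> < 1"
      "\<And>l v u. admissible E lk l \<Longrightarrow> v \<in> L2_perp \<mu> Nk \<inter> CqG q S G \<Longrightarrow> u \<in> Nk \<Longrightarrow>
         (\<lambda>x. F v x - l * v x) \<in> L2 \<mu> \<Longrightarrow>
         cmod (L2_inner \<mu> (\<lambda>x. F v x - l * v x) u)
           \<le> \<theta> * L2_norm \<mu> (\<lambda>x. F v x - l * v x) * L2_norm \<mu> u"
    and assm6_consts: "A > 0" "A' > 0" "p > 0" "Qa > 0"
  shows "\<exists>B\<^sub>t C\<^sub>t \<Lambda> \<Lambda>\<^sub>t :: real. B\<^sub>t > 0 \<and> C\<^sub>t > 0 \<and> \<Lambda> > 0 \<and> \<Lambda>\<^sub>t > 0 \<and>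
    (\<forall>x y :: nat \<Rightarrow> 'a.
       point_sequences S x y \<longrightarrow>
       \<comment> \<open>estimates for the discrete solution\<close>
       (\<exists>h0>0. \<forall>N\<ge>1. \<forall>Nb\<ge>1. h_max S x y N Nb < h0 \<longrightarrow>
          (\<forall>l. admissible E lk l \<longrightarrow>
             (\<exists>u. discrete_solution H ip F G Na a b x y N Nb l u) \<and>
             (\<forall>u. discrete_solution H ip F G Na a b x y N Nb l u \<longrightarrow>
                (\<lambda>z. F u z - l * u z) \<in> L2 \<mu> \<and>
                L2_norm \<mu> (\<lambda>z. F u z - l * u z) \<le> A * h_max S x y N Nb powr p * hnorm ip u \<and>
                G u \<in> boundary_Hs m S \<A> s \<and>
                boundary_Hs_norm m S \<A> s (G u) \<le> A' * h_max S x y N Nb powr p * hnorm ip u \<and>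
                L2_norm \<mu> u \<ge> bmax * Qa / hnorm ip u))) \<longrightarrow>
       \<comment> \<open>conclusion\<close>
       (\<exists>h1>0. \<forall>N\<ge>1. \<forall>Nb\<ge>1. h_max S x y N Nb < h1 \<longrightarrow>
          (\<forall>l u. admissible E lk l \<longrightarrow> discrete_solution H ip F G Na a b x y N Nb l u \<longrightarrow>
             (\<exists>v\<in>Nk.
                ((\<exists>w\<in>Nk. \<exists>z\<in>closure S. w z \<noteq> 0) \<longrightarrow> (\<exists>z\<in>closure S. v z \<noteq> 0)) \<and>
                (let \<kappa> = cmod (l - lk);
                     \<eta> = h_max S x y N Nb powr p * (hnorm ip u)\<^sup>2
                 in (B\<^sub>t + \<Lambda> * \<kappa>) * \<eta> < bmax * Qa \<longrightarrow>
                    (\<exists>z\<in>closure S. v z \<noteq> 0) \<and>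
                    \<kappa> \<le> (C\<^sub>t + \<Lambda>\<^sub>t * \<kappa>) * \<eta> / (bmax * Qa - (B\<^sub>t + \<Lambda> * \<kappa>) * \<eta>) \<and>
                    L2_norm \<mu> (\<lambda>z. u z - v z) / L2_norm \<mu> v
                      \<le> (B\<^sub>t + \<Lambda> * \<kappa>) * \<eta> / (bmax * Qa - (B\<^sub>t + \<Lambda> * \<kappa>) * \<eta>))))))"
proof -
  have "{1..Na} \<noteq> {}" using points(2) by blast
  then have bmax_ge: "cmod (b j) \<le> bmax" if "j \<in> {1..Na}" for j
    unfolding bmax using that by (intro Max_ge) auto
  then have bmax0: "bmax > 0" using points(2) by (metis norm_eq_zero norm_ge_zero less_le_trans order_le_less)
  interpret finite_measure \<mu>
    unfolding \<mu> by (rule finite_measure_bounded_domain[OF domain]) simp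
  have space: "space \<mu> = S"
    unfolding \<mu> by (simp add: space_restrict_space)
  have CqL2: "u \<in> L2 \<mu>" if "Ck_on q (closure S) u" for u
    unfolding \<mu> using continuous_on_closure_in_L2[OF domain _ Ck_on_imp_continuous_on[OF that]] by simp
  have bdS: "bd S \<subseteq> closure S" by (auto simp: bd_def)
  have Flin: "F (\<lambda>z. f z + c * g z) x = F f x + c * F g x"
    if "Ck_on q (closure S) f" "Ck_on q (closure S) g" "x \<in> S" for f g c x
    using differential_operator_lincomb[OF F(1) closure_subset] that by blast
  have Glin: "G (\<lambda>z. f z + c * g z) x = G f x + c * G g x"
    if "Ck_on q (closure S) f" "Ck_on q (closure S) g" "x \<in> bd S" for f g c x
    using differential_operator_lincomb[OF G(1) bdS] that Ck_on_mono[OF G(2)] by blast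
  have CqG_lincomb: "(\<lambda>x. f x + c * g x) \<in> CqG q S G" if "f \<in> CqG q S G" "g \<in> CqG q S G" for f g c
    using that Ck_on_lincomb[of q "closure S" f g c] Glin[of f g _ c] unfolding CqG_def by auto
  have Nk_iff: "f \<in> Nk \<longleftrightarrow> f \<in> CqG q S G \<and> (\<forall>x\<in>S. F f x = lk * f x)" for f
    unfolding Nk eigenspace_def by auto
  have CqG_Ck: "Ck_on q (closure S) f" if "f \<in> CqG q S G" for f
    using that by (simp add: CqG_def)
  have Nk_lincomb: "(\<lambda>x. f x + c * g x) \<in> Nk" if "f \<in> Nk" "g \<in> Nk" for f g c
    using that unfolding Nk_iff by (auto simp: CqG_lincomb Flin CqG_Ck algebra_simps)
  define \<tau> where "\<tau> = sqrt (1 - \<theta>)"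
  have \<tau>: "\<tau> > 0" using assm5(2) by (simp add: \<tau>_def)
  \<comment> \<open>With \<open>\<epsilon>\<close> the power of the fill distance times
    \<open>hnorm ip u\<close>, the norm of \<open>(F - l) w\<close> is at most \<open>\<tau> *
    (C\<^sub>t + \<Lambda>\<^sub>t * cmod (l - lk)) * \<epsilon>\<close>. Division by
    \<open>Bk\<close> bounds \<open>z\<close>, and adding the bound
    \<open>Ck * A' * \<epsilon>\<close> of \<open>g\<close> gives \<open>B\<^sub>t\<close> and
    \<open>\<Lambda>\<close>.\<close>
  define C\<^sub>t \<Lambda>\<^sub>t B\<^sub>t \<Lambda> where "C\<^sub>t = (A + cmod (\<alpha> - lk) * (Ck * A')) / \<tau>" and "\<Lambda>\<^sub>t = Ck * A' / \<tau>"
    and "B\<^sub>t = C\<^sub>t / Bk + Ck * A'" and "\<Lambda> = \<Lambda>\<^sub>t / Bk"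
  have CA: "Ck * A' > 0" using assm1(1) assm6_consts by simp
  have C\<^sub>t0: "C\<^sub>t > 0" unfolding C\<^sub>t_def
    using \<tau> assm6_consts CA by (intro divide_pos_pos add_pos_nonneg) auto
  have \<Lambda>\<^sub>t0: "\<Lambda>\<^sub>t > 0" using \<tau> CA by (simp add: \<Lambda>\<^sub>t_def)
  have B\<^sub>t0: "B\<^sub>t > 0" using C\<^sub>t0 CA assm4(1) by (simp add: B\<^sub>t_def add_pos_pos)
  have \<Lambda>0: "\<Lambda> > 0" using \<Lambda>\<^sub>t0 assm4(1) by (simp add: \<Lambda>_def)
  have decomposition: "\<exists>v\<in>Nk. cmod (l - lk) * L2_norm \<mu> v \<le> (C\<^sub>t + \<Lambda>\<^sub>t * cmod (l - lk)) * \<epsilon> \<and>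
      L2_norm \<mu> (\<lambda>z. u z - v z) \<le> (B\<^sub>t + \<Lambda> * cmod (l - lk)) * \<epsilon>"
    if l: "admissible E lk l" and u: "Ck_on q (closure S) u" and \<epsilon>: "\<epsilon> \<ge> 0"
      and res: "(\<lambda>z. F u z - l * u z) \<in> L2 \<mu>" "L2_norm \<mu> (\<lambda>z. F u z - l * u z) \<le> A * \<epsilon>"
      and Gu: "G u \<in> boundary_Hs m S \<A> s" "boundary_Hs_norm m S \<A> s (G u) \<le> A' * \<epsilon>"
    for l u \<epsilon>
  proof -
    obtain g where g: "Ck_on q (closure S) g" "\<And>x. x \<in> S \<Longrightarrow> F g x = \<alpha> * g x"
      "\<And>x. x \<in> bd S \<Longrightarrow> G g x = G u x" "L2_norm \<mu> g \<le> Ck * boundary_Hs_norm m S \<A> s (G u)"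
      using assm1(2)[OF Ck_on_mono[OF G(2) u]] Gu(1) by auto
    have "Ck * boundary_Hs_norm m S \<A> s (G u) \<le> Ck * (A' * \<epsilon>)"
      using Gu(2) assm1(1) by (intro mult_left_mono) auto
    then have g_le: "L2_norm \<mu> g \<le> Ck * A' * \<epsilon>" using g(4) by (simp add: mult.assoc)
    have gL2: "g \<in> L2 \<mu>" by (rule CqL2[OF g(1)])
    define w where "w = (\<lambda>x. u x - g x)"
    have w_eq: "w = (\<lambda>x. u x + (-1) * g x)" by (simp add: w_def)
    have w: "w \<in> CqG q S G"
      unfolding w_eq CqG_def
      using Ck_on_lincomb[OF u g(1), of "-1"] Glin[OF u g(1), of _ "-1"] g(3) by simp
    obtain v where v: "v \<in> Nk" "(\<lambda>x. w x - v x) \<in> L2_perp \<mu> Nk"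
    proof (rule L2_projection[OF assm3 _ Nk_lincomb CqL2[OF CqG_Ck[OF w]]])
      \<comment> \<open>The zero function, written as \<open>w - w\<close> so that linearity of
        \<open>F\<close> and \<open>G\<close> applies.\<close>
      have "(\<lambda>x. w x + (-1) * w x) \<in> CqG q S G" by (rule CqG_lincomb[OF w w])
      then have "(\<lambda>x. w x + (-1) * w x) \<in> Nk"
        unfolding Nk_iff using Flin[OF CqG_Ck[OF w] CqG_Ck[OF w], of _ "-1"] by simp
      then show "Nk \<noteq> {}" by blast
    qed (use that in blast)+
    have vG: "v \<in> CqG q S G" and Fv: "\<And>x. x \<in> S \<Longrightarrow> F v x = lk * v x" using v(1) by (auto simp: Nk_iff)
    have vL2: "v \<in> L2 \<mu>" by (rule CqL2[OF CqG_Ck[OF vG]])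
    define z where "z = (\<lambda>x. w x - v x)"
    have z_eq: "z = (\<lambda>x. w x + (-1) * v x)" by (simp add: z_def)
    have zG: "z \<in> CqG q S G" unfolding z_eq by (rule CqG_lincomb[OF w vG])
    have z: "z \<in> L2_perp \<mu> Nk \<inter> CqG q S G" using v(2) zG by (simp add: z_def)
    have zL2: "z \<in> L2 \<mu>" by (rule CqL2[OF CqG_Ck[OF zG]])
    define r where "r = (\<lambda>x. F u x - l * u x)"
    \<comment> \<open>This is \<open>(F - l) w\<close> on \<open>S\<close>, because
      \<open>F g = \<alpha> * g\<close> there.\<close>
    define \<rho> where "\<rho> = (\<lambda>x. r x + (l - \<alpha>) * g x)"
    define y where "y = (\<lambda>x. F z x - l * z x)"
    have \<rho>L2: "\<rho> \<in> L2 \<mu>" unfolding \<rho>_def r_def by (rule L2_lincomb[OF res(1) gL2])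
    have y_eq: "y x + (lk - l) * v x = \<rho> x" if x: "x \<in> S" for x
    proof -
      have "F z x = F w x + (-1) * F v x"
        unfolding z_eq by (rule Flin[OF CqG_Ck[OF w] CqG_Ck[OF vG] x])
      also have "F w x = F u x + (-1) * F g x"
        unfolding w_eq by (rule Flin[OF u g(1) x])
      finally have "F z x = F u x - \<alpha> * g x - lk * v x" by (simp add: g(2)[OF x] Fv[OF x])
      then show ?thesis by (simp add: y_def \<rho>_def r_def z_def w_def algebra_simps)
    qed
    \<comment> \<open>\<open>F z\<close> might be unbounded near the boundary; the identity
      \<open>y_eq\<close> replaces it by functions known to be square integrable.\<close>
    have yL2: "y \<in> L2 \<mu>"
    proof -
      have "(\<lambda>x. \<rho> x + (l - lk) * v x) \<in> L2 \<mu>" by (rule L2_lincomb[OF \<rho>L2 vL2])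
      moreover have "(\<lambda>x. \<rho> x + (l - lk) * v x) \<in> L2 \<mu> \<longleftrightarrow> y \<in> L2 \<mu>"
        by (rule L2_cong) (simp add: space algebra_simps flip: y_eq)
      ultimately show ?thesis by simp
    qed
    have sum_eq: "L2_norm \<mu> (\<lambda>x. y x + (lk - l) * v x) = L2_norm \<mu> \<rho>"
      by (intro L2_norm_cong) (simp add: space y_eq)
    have angle: "cmod (L2_inner \<mu> y v) \<le> \<theta> * L2_norm \<mu> y * L2_norm \<mu> v"
      unfolding y_def by (rule assm5(3)[OF l z v(1)]) (use yL2 in \<open>simp add: y_def\<close>)
    have yv: "\<tau> * L2_norm \<mu> y \<le> L2_norm \<mu> \<rho>" "\<tau> * (cmod (l - lk) * L2_norm \<mu> v) \<le> L2_norm \<mu> \<rho>"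
      using L2_norm_strengthened_Cauchy_Schwarz[OF yL2 vL2 angle assm5(1,2), of "lk - l"]
      unfolding sum_eq \<tau>_def by (simp_all add: norm_minus_commute)
    have "L2_norm \<mu> (\<lambda>x. r x + (l - \<alpha>) * g x) \<le> L2_norm \<mu> r + L2_norm \<mu> (\<lambda>x. (l - \<alpha>) * g x)"
    proof (rule L2_norm_triangle)
      show "r \<in> L2 \<mu>" using res(1) by (simp add: r_def)
      show "(\<lambda>x. (l - \<alpha>) * g x) \<in> L2 \<mu>" using L2_lincomb[OF gL2 gL2, of "l - \<alpha> - 1"]
        by (simp add: algebra_simps)
    qed
    then have "L2_norm \<mu> \<rho> \<le> L2_norm \<mu> r + cmod (l - \<alpha>) * L2_norm \<mu> g"
      by (simp add: \<rho>_def L2_norm_scale)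
    also have "\<dots> \<le> A * \<epsilon> + (cmod (\<alpha> - lk) + cmod (l - lk)) * (Ck * A' * \<epsilon>)"
    proof (intro add_mono mult_mono)
      show "L2_norm \<mu> r \<le> A * \<epsilon>" using res(2) by (simp add: r_def)
      \<comment> \<open>Here the eigenvalue error enters the right-hand side.\<close>
      show "cmod (l - \<alpha>) \<le> cmod (\<alpha> - lk) + cmod (l - lk)"
        using norm_triangle_ineq4[of "l - lk" "\<alpha> - lk"] by simp
    qed (use g_le in auto)
    also have "\<dots> = \<tau> * ((C\<^sub>t + \<Lambda>\<^sub>t * cmod (l - lk)) * \<epsilon>)"
      using \<tau> by (simp add: C\<^sub>t_def \<Lambda>\<^sub>t_def field_simps)
    finally have \<rho>_le: "L2_norm \<mu> \<rho> \<le> \<tau> * ((C\<^sub>t + \<Lambda>\<^sub>t * cmod (l - lk)) * \<epsilon>)" .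
    have v_le: "cmod (l - lk) * L2_norm \<mu> v \<le> (C\<^sub>t + \<Lambda>\<^sub>t * cmod (l - lk)) * \<epsilon>"
      using order_trans[OF yv(2) \<rho>_le] \<tau> by (simp only: mult_le_cancel_left_pos)
    have "L2_norm \<mu> y \<le> (C\<^sub>t + \<Lambda>\<^sub>t * cmod (l - lk)) * \<epsilon>"
      using order_trans[OF yv(1) \<rho>_le] \<tau> by (simp only: mult_le_cancel_left_pos)
    moreover have "Bk * L2_norm \<mu> z \<le> L2_norm \<mu> y"
      unfolding y_def by (rule assm4(2)[OF l z]) (use yL2 in \<open>simp add: y_def\<close>)
    ultimately have z_le: "L2_norm \<mu> z \<le> (C\<^sub>t + \<Lambda>\<^sub>t * cmod (l - lk)) * \<epsilon> / Bk"
      using assm4(1) by (simp add: pos_le_divide_eq mult.commute)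
    have "(\<lambda>x. u x - v x) = (\<lambda>x. z x + g x)" by (simp add: z_def w_def fun_eq_iff)
    then have "L2_norm \<mu> (\<lambda>x. u x - v x) \<le> L2_norm \<mu> z + L2_norm \<mu> g"
      using L2_norm_triangle[OF zL2 gL2] by simp
    also have "\<dots> \<le> (C\<^sub>t + \<Lambda>\<^sub>t * cmod (l - lk)) * \<epsilon> / Bk + Ck * A' * \<epsilon>"
      by (intro add_mono z_le g_le)
    also have "\<dots> = (B\<^sub>t + \<Lambda> * cmod (l - lk)) * \<epsilon>"
      by (simp add: B\<^sub>t_def \<Lambda>_def add_divide_distrib algebra_simps)
    finally show ?thesis using v(1) v_le by blast
  qed
  have conclusion: "\<exists>v\<in>Nk.
      ((\<exists>w\<in>Nk. \<exists>z\<in>closure S. w z \<noteq> 0) \<longrightarrow> (\<exists>z\<in>closure S. v z \<noteq> 0)) \<and>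
      (let \<kappa> = cmod (l - lk);
           \<eta> = h powr p * (hnorm ip u)\<^sup>2
       in (B\<^sub>t + \<Lambda> * \<kappa>) * \<eta> < bmax * Qa \<longrightarrow>
          (\<exists>z\<in>closure S. v z \<noteq> 0) \<and>
          \<kappa> \<le> (C\<^sub>t + \<Lambda>\<^sub>t * \<kappa>) * \<eta> / (bmax * Qa - (B\<^sub>t + \<Lambda> * \<kappa>) * \<eta>) \<and>
          L2_norm \<mu> (\<lambda>z. u z - v z) / L2_norm \<mu> v
            \<le> (B\<^sub>t + \<Lambda> * \<kappa>) * \<eta> / (bmax * Qa - (B\<^sub>t + \<Lambda> * \<kappa>) * \<eta>))"
    if l: "admissible E lk l" and sol: "discrete_solution H ip F G Na a b x y N Nb l u"
      and res: "(\<lambda>z. F u z - l * u z) \<in> L2 \<mu>"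
        "L2_norm \<mu> (\<lambda>z. F u z - l * u z) \<le> A * h powr p * hnorm ip u"
      and Gu: "G u \<in> boundary_Hs m S \<A> s"
        "boundary_Hs_norm m S \<A> s (G u) \<le> A' * h powr p * hnorm ip u"
      and low: "L2_norm \<mu> u \<ge> bmax * Qa / hnorm ip u"
    for x y N Nb l u h
  proof -
    have uH: "u \<in> H" and ub: "\<And>j. j \<in> {1..Na} \<Longrightarrow> u (a j) = b j"
      using sol unfolding discrete_solution_def is_arg_min_def by auto
    obtain j where "j \<in> {1..Na}" "b j \<noteq> 0" using points(2) by blast
    \<comment> \<open>The interpolation condition at a point with non-zero value excludes
      \<open>u = 0\<close>.\<close>
    then have n0: "hnorm ip u > 0" using hnorm_pos[OF H(1) uH, of "a j"] ub by simp
    have u: "Ck_on q (closure S) u" by (rule H(2)[OF uH])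
    define n \<kappa> \<epsilon> where "n = hnorm ip u" and "\<kappa> = cmod (l - lk)" and "\<epsilon> = h powr p * n"
    have n: "n > 0" using n0 by (simp add: n_def)
    have \<epsilon>: "\<epsilon> \<ge> 0" using n by (simp add: \<epsilon>_def)
    obtain v where v: "v \<in> Nk" "\<kappa> * L2_norm \<mu> v \<le> (C\<^sub>t + \<Lambda>\<^sub>t * \<kappa>) * \<epsilon>"
      "L2_norm \<mu> (\<lambda>z. u z - v z) \<le> (B\<^sub>t + \<Lambda> * \<kappa>) * \<epsilon>"
      using decomposition[OF l u \<epsilon> res(1) _ Gu(1)] res(2) Gu(2)
      unfolding n_def \<kappa>_def \<epsilon>_def by (auto simp: mult.assoc)
    have \<eta>: "h powr p * (hnorm ip u)\<^sup>2 = \<epsilon> * n" by (simp add: \<epsilon>_def n_def power2_eq_square)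
    show ?thesis
    \<comment> \<open>The eigenfunction is quantified outside the smallness condition, so a choice
      is owed even when the condition fails.\<close>
    proof (cases "(B\<^sub>t + \<Lambda> * \<kappa>) * (\<epsilon> * n) < bmax * Qa")
      case True
      define d where "d = bmax * Qa - (B\<^sub>t + \<Lambda> * \<kappa>) * (\<epsilon> * n)"
      have d: "d > 0" using True by (simp add: d_def)
      have vL2: "v \<in> L2 \<mu>" using v(1) by (simp add: Nk_iff CqG_Ck CqL2)
      have "(\<lambda>x. u x - v x) \<in> L2 \<mu>" using L2_lincomb[OF CqL2[OF u] vL2, of "-1"] by simp
      then have "L2_norm \<mu> u \<le> L2_norm \<mu> (\<lambda>x. u x - v x) + L2_norm \<mu> v"
        using L2_norm_triangle[OF _ vL2, of "\<lambda>x. u x - v x"] by simp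
      then have "bmax * Qa / n \<le> (B\<^sub>t + \<Lambda> * \<kappa>) * \<epsilon> + L2_norm \<mu> v"
        using v(3) low by (simp add: n_def)
      then have "d \<le> L2_norm \<mu> v * n"
        using n by (simp add: d_def pos_divide_le_eq algebra_simps)
      then have dn: "d / n \<le> L2_norm \<mu> v" using n by (simp add: pos_divide_le_eq)
      moreover have "d / n > 0" using d n by simp
      ultimately have v0: "L2_norm \<mu> v > 0" by linarith
      then have nz: "\<exists>z\<in>closure S. v z \<noteq> 0"
        using L2_norm_pos_imp_nonzero[OF v0] space closure_subset by (metis subsetD)
      \<comment> \<open>The lower bound \<open>d / n\<close> for the norm of \<open>v\<close> turns
        both estimates into quotients: \<open>t\<close> is the eigenvalue error in one and the
        relative error of \<open>u\<close> in the other.\<close>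
      have div: "t \<le> c * (\<epsilon> * n) / d" if "t * L2_norm \<mu> v \<le> c * \<epsilon>" "t \<ge> 0" for t c
      proof -
        have "t * (d / n) \<le> c * \<epsilon>"
          using mult_left_mono[OF dn that(2)] that(1) by linarith
        then show ?thesis using d n by (simp add: field_simps)
      qed
      have "\<kappa> \<le> (C\<^sub>t + \<Lambda>\<^sub>t * \<kappa>) * (\<epsilon> * n) / d"
        using v(2) by (intro div) (auto simp: \<kappa>_def)
      moreover have "L2_norm \<mu> (\<lambda>z. u z - v z) / L2_norm \<mu> v \<le> (B\<^sub>t + \<Lambda> * \<kappa>) * (\<epsilon> * n) / d"
        using v(3) v0 by (intro div) auto
      ultimately show ?thesis
        using v(1) nz unfolding \<eta> Let_def d_def \<kappa>_def by blast
    next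
      case False
      \<comment> \<open>The estimates are vacuous here, and only non-triviality of the chosen member
        of \<open>Nk\<close> matters.\<close>
      show ?thesis
      proof (cases "\<exists>w\<in>Nk. \<exists>z\<in>closure S. w z \<noteq> 0")
        case True
        then obtain w where "w \<in> Nk" "\<exists>z\<in>closure S. w z \<noteq> 0" by blast
        then show ?thesis
          using False unfolding \<eta> Let_def \<kappa>_def by (intro bexI[of _ w] conjI impI) simp_all
      next
        case nontrivial: False
        then show ?thesis using v(1) False unfolding \<eta> Let_def \<kappa>_def by blast
      qed
    qed
  qed
  show ?thesis
  proof (rule exI[of _ B\<^sub>t], rule exI[of _ C\<^sub>t], rule exI[of _ \<Lambda>], rule exI[of _ \<Lambda>\<^sub>t],
      intro conjI allI impI)
    fix x y :: "nat \<Rightarrow> 'a"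
    assume "point_sequences S x y"
    assume "\<exists>h0>0. \<forall>N\<ge>1. \<forall>Nb\<ge>1. h_max S x y N Nb < h0 \<longrightarrow>
          (\<forall>l. admissible E lk l \<longrightarrow>
             (\<exists>u. discrete_solution H ip F G Na a b x y N Nb l u) \<and>
             (\<forall>u. discrete_solution H ip F G Na a b x y N Nb l u \<longrightarrow>
                (\<lambda>z. F u z - l * u z) \<in> L2 \<mu> \<and>
                L2_norm \<mu> (\<lambda>z. F u z - l * u z) \<le> A * h_max S x y N Nb powr p * hnorm ip u \<and>
                G u \<in> boundary_Hs m S \<A> s \<and>
                boundary_Hs_norm m S \<A> s (G u) \<le> A' * h_max S x y N Nb powr p * hnorm ip u \<and>
                L2_norm \<mu> u \<ge> bmax * Qa / hnorm ip u))"
    then obtain h0 where "h0 > 0" and h0: "\<And>N Nb l u. N \<ge> 1 \<Longrightarrow> Nb \<ge> 1 \<Longrightarrow> h_max S x y N Nb < h0 \<Longrightarrow>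
        admissible E lk l \<Longrightarrow> discrete_solution H ip F G Na a b x y N Nb l u \<Longrightarrow>
                (\<lambda>z. F u z - l * u z) \<in> L2 \<mu> \<and>
                L2_norm \<mu> (\<lambda>z. F u z - l * u z) \<le> A * h_max S x y N Nb powr p * hnorm ip u \<and>
                G u \<in> boundary_Hs m S \<A> s \<and>
                boundary_Hs_norm m S \<A> s (G u) \<le> A' * h_max S x y N Nb powr p * hnorm ip u \<and>
                L2_norm \<mu> u \<ge> bmax * Qa / hnorm ip u"
      by blast
    show "\<exists>h1>0. \<forall>N\<ge>1. \<forall>Nb\<ge>1. h_max S x y N Nb < h1 \<longrightarrow>
          (\<forall>l u. admissible E lk l \<longrightarrow> discrete_solution H ip F G Na a b x y N Nb l u \<longrightarrow>
             (\<exists>v\<in>Nk.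
                ((\<exists>w\<in>Nk. \<exists>z\<in>closure S. w z \<noteq> 0) \<longrightarrow> (\<exists>z\<in>closure S. v z \<noteq> 0)) \<and>
                (let \<kappa> = cmod (l - lk);
                     \<eta> = h_max S x y N Nb powr p * (hnorm ip u)\<^sup>2
                 in (B\<^sub>t + \<Lambda> * \<kappa>) * \<eta> < bmax * Qa \<longrightarrow>
                    (\<exists>z\<in>closure S. v z \<noteq> 0) \<and>
                    \<kappa> \<le> (C\<^sub>t + \<Lambda>\<^sub>t * \<kappa>) * \<eta> / (bmax * Qa - (B\<^sub>t + \<Lambda> * \<kappa>) * \<eta>) \<and>
                    L2_norm \<mu> (\<lambda>z. u z - v z) / L2_norm \<mu> v
                      \<le> (B\<^sub>t + \<Lambda> * \<kappa>) * \<eta> / (bmax * Qa - (B\<^sub>t + \<Lambda> * \<kappa>) * \<eta>))))"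
    proof (intro exI[of _ h0] conjI allI impI)
      fix N Nb l u
      assume asm: "1 \<le> N" "1 \<le> Nb" "h_max S x y N Nb < h0" "admissible E lk l"
        "discrete_solution H ip F G Na a b x y N Nb l u"
      note est = h0[OF asm]
      show "\<exists>v\<in>Nk.
                ((\<exists>w\<in>Nk. \<exists>z\<in>closure S. w z \<noteq> 0) \<longrightarrow> (\<exists>z\<in>closure S. v z \<noteq> 0)) \<and>
                (let \<kappa> = cmod (l - lk);
                     \<eta> = h_max S x y N Nb powr p * (hnorm ip u)\<^sup>2
                 in (B\<^sub>t + \<Lambda> * \<kappa>) * \<eta> < bmax * Qa \<longrightarrow>
                    (\<exists>z\<in>closure S. v z \<noteq> 0) \<and>
                    \<kappa> \<le> (C\<^sub>t + \<Lambda>\<^sub>t * \<kappa>) * \<eta> / (bmax * Qa - (B\<^sub>t + \<Lambda> * \<kappa>) * \<eta>) \<and>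
                    L2_norm \<mu> (\<lambda>z. u z - v z) / L2_norm \<mu> v
                      \<le> (B\<^sub>t + \<Lambda> * \<kappa>) * \<eta> / (bmax * Qa - (B\<^sub>t + \<Lambda> * \<kappa>) * \<eta>))"
        using est by (intro conclusion[OF asm(4,5)]) blast+
    qed (rule \<open>h0 > 0\<close>)
  qed (rule B\<^sub>t0 C\<^sub>t0 \<Lambda>0 \<Lambda>\<^sub>t0)+
qed

end
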